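(* For every integer $c \geq 5$, every planar graph with girth at least $\left\lceil \frac{4c}{c-2} \right\rceil$ is odd $c$-colorable.
   Context: All graphs are finite and simple (no loops, no parallel edges). The girth of a graph is the length of its shortest cycle (infinite if it has no cycle). An odd $c$-coloring of a graph is a proper coloring of its vertices with (at most) $c$ colors such that, for each vertex $v$ of positive degree, some color appears an odd number of times on the neighborhood of $v$. A graph is odd $c$-colorable if it has an odd $c$-coloring. *)

theory Defs
  imports "HOL-Analysis.Analysis" "Graph_Theory.Pair_Digraph"
begin

text \<open>
  A finite simple graph is a \<open>pair_graph\<close>: a finite vertex set with a symmetric irreflexive
  adjacency relation, so that an undirected edge \<open>uv\<close> occurs as the two arcs \<open>(u, v)\<close> and \<open>(v, u)\<close>.
\<close>

definition neighbors :: "'a pair_pre_digraph \<Rightarrow> 'a \<Rightarrow> 'a set" where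
  "neighbors G v = {u. (v, u) \<in> parcs G}"

definition degree :: "'a pair_pre_digraph \<Rightarrow> 'a \<Rightarrow> nat" where
  "degree G v = card (neighbors G v)"

text \<open>
  \<open>pre_digraph.cycle\<close> also accepts the closed walk \<open>[(u, v), (v, u)]\<close> along a single edge,
  which is not a cycle of the undirected graph; hence the bound on the length.
  The infimum of the empty set in \<open>enat\<close> is \<open>\<infinity>\<close>.
\<close>

definition girth :: "'a pair_pre_digraph \<Rightarrow> enat" where
  "girth G = (INF p \<in> {p. pre_digraph.cycle (with_proj G) p \<and> 3 \<le> length p}. enat (length p))"

text \<open>
  A drawing in the plane \<open>\<complex>\<close>: vertices are distinct points, each edge is a simple arc joining its
  ends and containing no other vertex, and two distinct edges meet only in common ends.
  The two orientations of an edge are drawn as one and the same curve.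
\<close>

definition plane_drawing ::
  "'a pair_pre_digraph \<Rightarrow> ('a \<Rightarrow> complex) \<Rightarrow> ('a \<times> 'a \<Rightarrow> real \<Rightarrow> complex) \<Rightarrow> bool" where
  "plane_drawing G pos \<gamma> \<longleftrightarrow>
     inj_on pos (pverts G) \<and>
     (\<forall>(u, v) \<in> parcs G.
        arc (\<gamma> (u, v)) \<and> pathstart (\<gamma> (u, v)) = pos u \<and> pathfinish (\<gamma> (u, v)) = pos v \<and>
        \<gamma> (v, u) = reversepath (\<gamma> (u, v)) \<and>
        path_image (\<gamma> (u, v)) \<inter> pos ` pverts G = {pos u, pos v}) \<and>
     (\<forall>(u, v) \<in> parcs G. \<forall>(x, y) \<in> parcs G. {u, v} \<noteq> {x, y} \<longrightarrow>
        path_image (\<gamma> (u, v)) \<inter> path_image (\<gamma> (x, y)) \<subseteq> pos ` ({u, v} \<inter> {x, y}))"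

definition planar :: "'a pair_pre_digraph \<Rightarrow> bool" where
  "planar G \<longleftrightarrow> (\<exists>pos \<gamma>. plane_drawing G pos \<gamma>)"

definition proper_coloring :: "'a pair_pre_digraph \<Rightarrow> nat \<Rightarrow> ('a \<Rightarrow> nat) \<Rightarrow> bool" where
  "proper_coloring G c f \<longleftrightarrow>
     f ` pverts G \<subseteq> {..<c} \<and> (\<forall>(u, v) \<in> parcs G. f u \<noteq> f v)"

definition odd_coloring :: "'a pair_pre_digraph \<Rightarrow> nat \<Rightarrow> ('a \<Rightarrow> nat) \<Rightarrow> bool" where
  "odd_coloring G c f \<longleftrightarrow>
     proper_coloring G c f \<and>
     (\<forall>v \<in> pverts G. degree G v > 0 \<longrightarrow> (\<exists>i<c. odd (card {u \<in> neighbors G v. f u = i})))"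

definition odd_colorable :: "'a pair_pre_digraph \<Rightarrow> nat \<Rightarrow> bool" where
  "odd_colorable G c \<longleftrightarrow> (\<exists>f. odd_coloring G c f)"

end

theory Submission
  imports Defs
begin

text \<open>
  A plane graph on \<open>n\<close> vertices all of whose cycles have length at least \<open>g\<close> has fewer than
  \<open>g n / (g - 2)\<close> edges. This is Euler's formula plus double counting: an edge borders at most two faces, and
  if there are two faces, then the edges with \<open>F\<close> on exactly one side separate the plane and hence
  contain a cycle, for every face \<open>F\<close>. For \<open>g \<ge> 4c / (c - 2)\<close> the average degree is therefore
  less than \<open>4c / (c + 2)\<close>.

  A vertex \<open>v\<close> of degree \<open>d\<close> with \<open>k\<close> neighbours of degree two, where \<open>d\<close> is odd or \<open>k > 0\<close>, can be
  deleted together with these neighbours and coloured last if \<open>2d - k < c\<close>. If no vertex is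
  reducible in this way and every vertex of degree two takes charge \<open>(c - 2) / (c + 2)\<close> from
  each neighbour, then every vertex ends with charge at least \<open>4c / (c + 2)\<close>. For \<open>c = 5\<close> the
  weaker bound \<open>14/5\<close> suffices, since the girth is at least seven.
\<close>

text \<open>Only one inequality of Euler's formula is used, and it is proved edge by edge. The
  Jordan curve theorem yields that an edge closing a curve splits a face; the delicate point is that
  a face never falls into three pieces, whatever has been drawn before. Borsuk's criterion turns
  this into the gluing of complex logarithms over the two ends of the edge. Faces are handled
  without facial walks: the edges around a face are known only to separate the plane, and stripping
  pendant edges by Janiszewski's theorem leaves a set in which a cycle exists for purely
  combinatorial reasons. For the colouring, a vertex added last to a neighbourhood changes the
  parity of one colour only, so it has at most one colour to avoid on that account; girth at least
  five ensures that every surviving vertex loses at most one neighbour. The two average degrees are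
  \<open>2 g / (g - 2)\<close> for \<open>g = 4 c / (c - 2)\<close> and for \<open>g = 7\<close>.
  The value \<open>c = 5\<close> stands apart because the balance at a vertex of degree
  \<open>d\<close> contains a term \<open>(c - 6) (c - d)\<close>.\<close>

section \<open>Separation of the plane by an arc attached to a compact set\<close>

text \<open>Borsuk's criterion: two points share a component iff their Borsuk maps into the circle
  are homotopic, iff the quotient \<open>N\<close> of these maps has a logarithm. The modulus always
  has the real logarithm \<open>r\<close>, so normalising makes no difference. The gain is that
  logarithms can be added and glued.\<close>

lemma connected_component_iff_continuous_logarithm:
  fixes a b :: complex
  assumes "compact S" "a \<notin> S" "b \<notin> S"
  shows "connected_component (- S) a b \<longleftrightarrow>
    (\<exists>g. continuous_on S g \<and> (\<forall>x\<in>S. (x - a) / (x - b) = exp (g x)))"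
proof -
  define N where "N = (\<lambda>x. (x - a) /\<^sub>R cmod (x - a) / ((x - b) /\<^sub>R cmod (x - b)))"
  define r where "r = (\<lambda>x. ln (cmod (x - a)) - ln (cmod (x - b)))"
  have contr: "continuous_on S r"
    unfolding r_def using assms by (intro continuous_intros) auto
  have rN: "(x - a) / (x - b) = exp (of_real (r x)) * N x" if "x \<in> S" for x
  proof -
    have "x \<noteq> a" "x \<noteq> b" using that assms by auto
    then have "exp (complex_of_real (r x)) = of_real (cmod (x - a)) / of_real (cmod (x - b))"
      unfolding r_def exp_of_real by (simp add: exp_diff)
    then show ?thesis using \<open>x \<noteq> a\<close> \<open>x \<noteq> b\<close>
      by (simp add: N_def scaleR_conv_of_real field_simps)
  qed
  have normN: "norm (N x) = 1" if "x \<in> S" for x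
  proof -
    have "x \<noteq> a" "x \<noteq> b" using that assms by auto
    then show ?thesis by (simp add: N_def norm_divide)
  qed
  have "continuous_on S (\<lambda>x. (x - a) /\<^sub>R cmod (x - a))" "continuous_on S (\<lambda>x. (x - b) /\<^sub>R cmod (x - b))"
    using assms by (intro continuous_intros; force)+
  moreover have "(\<lambda>x. (x - a) /\<^sub>R cmod (x - a)) ` S \<subseteq> sphere 0 1" "(\<lambda>x. (x - b) /\<^sub>R cmod (x - b)) ` S \<subseteq> sphere 0 1"
    using assms by (auto simp: divide_simps)
  ultimately have "connected_component (- S) a b \<longleftrightarrow>
      (\<exists>g. continuous_on S g \<and> (\<forall>x\<in>S. N x = exp (\<i> * of_real (g x))))"
    unfolding N_def using assms
    by (subst Borsuk_maps_homotopic_in_connected_component_eq [symmetric], simp_all)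
      (subst homotopic_circlemaps_divide, auto simp: inessential_eq_continuous_logarithm_circle)
  also have "\<dots> \<longleftrightarrow> (\<exists>g. continuous_on S g \<and> (\<forall>x\<in>S. (x - a) / (x - b) = exp (g x)))"
    (is "?L \<longleftrightarrow> ?R")
  proof
    assume ?L
    then obtain g where g: "continuous_on S g" "\<forall>x\<in>S. N x = exp (\<i> * of_real (g x))" by blast
    have "continuous_on S (\<lambda>x. complex_of_real (r x) + \<i> * of_real (g x))"
      using contr g by (intro continuous_intros)
    moreover have "\<forall>x\<in>S. (x - a) / (x - b) = exp (complex_of_real (r x) + \<i> * of_real (g x))"
      using g rN by (simp add: exp_add)
    ultimately show ?R by blast
  next
    assume ?R
    then obtain g where g: "continuous_on S g" "\<forall>x\<in>S. (x - a) / (x - b) = exp (g x)" by blast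
    have "N x = exp (\<i> * of_real (Im (g x)))" if "x \<in> S" for x
    proof -
      have eq: "exp (g x) = exp (of_real (r x)) * N x" using g rN that by simp
      then have "exp (Re (g x)) = exp (r x)"
        using normN[OF that] by (metis mult.right_neutral norm_exp_eq_Re norm_mult Re_complex_of_real)
      then have "Re (g x) = r x" by simp
      then have "exp (g x) = exp (of_real (r x)) * exp (\<i> * of_real (Im (g x)))"
        by (metis complex_eq exp_add)
      with eq show ?thesis by simp
    qed
    moreover have "continuous_on S (\<lambda>x. Im (g x))" using g by (intro continuous_intros)
    ultimately show ?L by blast
  qed
  finally show ?thesis .
qed

text \<open>A winding number obstruction. A logarithm on \<open>X\<close> would allow
  \<open>(x - b) powi k\<close> to be continued from outside over the whole bounded component of
  \<open>b\<close> without zeros. A zero-free map of a disc has a logarithm, whereas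
  \<open>(x - b) powi k\<close> winds \<open>k\<close> times around a large circle.\<close>

lemma no_logarithm_bounded_component:
  fixes b :: complex and k :: int
  assumes "compact X" "b \<notin> X" and bdd: "bounded (connected_component_set (- X) b)" and "k \<noteq> 0"
    and contu: "continuous_on (connected_component_set (- X) b \<union> X) u"
    and u0: "\<And>x. x \<in> connected_component_set (- X) b \<union> X \<Longrightarrow> u x \<noteq> 0"
    and contl: "continuous_on X l" and l: "\<And>x. x \<in> X \<Longrightarrow> exp (l x) = (x - b) powi k * u x"
  shows False
proof -
  define B where "B = connected_component_set (- X) b"
  have "closed X" using assms compact_imp_closed by blast
  have "open B" unfolding B_def using \<open>closed X\<close> by (simp add: open_Compl open_connected_component)
  have "b \<in> B" using assms by (simp add: B_def)
  have "closed (B \<union> X)"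
  proof -
    have "- (B \<union> X) = \<Union> (components (- X) - {B})"
      using in_components_unions_complement[of B "- X"] componentsI[of b "- X"] assms(2) B_def by auto
    moreover have "open (\<Union> (components (- X) - {B}))"
      using open_components[of "- X"] \<open>closed X\<close> by (intro open_Union) (auto simp: open_Compl)
    ultimately show ?thesis by (simp add: closed_def)
  qed
  obtain l' where contl': "continuous_on UNIV l'" and l': "\<And>x. x \<in> X \<Longrightarrow> l' x = l x"
  proof -
    obtain g where "continuous_on UNIV g" "\<And>x. x \<in> X \<Longrightarrow> g x = l x"
      using Tietze_unbounded[of X l UNIV] contl \<open>closed X\<close> by auto
    then show ?thesis using that by blast
  qed
  have "bounded (B \<union> X)" using bdd assms(1) by (simp add: B_def compact_imp_bounded)
  then obtain r where "r > 0" and r: "B \<union> X \<subseteq> ball b r"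
    using bounded_subset_ballD by blast
  \<comment> \<open>The two branches agree on \<open>X\<close>, the common part of
    \<open>B \<union> X\<close> and \<open>- B\<close>, so \<open>G\<close> is continuous.\<close>
  define G where "G = (\<lambda>x. if x \<in> B \<union> X then exp (l' x) / u x else (x - b) powi k)"
  have contG: "continuous_on (cball b r) G"
  proof -
    have "continuous_on ((B \<union> X) \<union> (- B)) G"
      unfolding G_def
    proof (rule continuous_on_cases)
      show "closed (B \<union> X)" by fact
      show "closed (- B)" using \<open>open B\<close> by auto
      show "continuous_on (B \<union> X) (\<lambda>x. exp (l' x) / u x)"
        using contl' contu u0 unfolding B_def
        by (intro continuous_intros) (auto intro: continuous_on_subset)
      show "continuous_on (- B) (\<lambda>x. (x - b) powi k)"
        using \<open>b \<in> B\<close> by (intro continuous_intros) auto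
      show "\<forall>x. x \<in> B \<union> X \<and> x \<notin> B \<union> X \<or> x \<in> - B \<and> x \<in> B \<union> X \<longrightarrow> exp (l' x) / u x = (x - b) powi k"
        using l l' u0 by (auto simp: B_def)
    qed
    then show ?thesis by (rule continuous_on_subset) auto
  qed
  have "G z \<noteq> 0" for z
    using u0 \<open>b \<in> B\<close> by (auto simp: G_def B_def)
  then obtain h where conth: "continuous_on (cball b r) h" and h: "\<And>z. z \<in> cball b r \<Longrightarrow> G z = exp (h z)"
    using continuous_logarithm_on_cball[OF contG] by blast
  \<comment> \<open>A logarithm of the power yields one of \<open>x - b\<close>: the values of
    \<open>w\<close> are roots of unity, so \<open>w\<close> is constant on the connected
    circle.\<close>
  define w where "w = (\<lambda>x. (x - b) * exp (- h x / of_int k))"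
  have bs: "b \<notin> sphere b r" using \<open>r > 0\<close> by auto
  have wk: "w x powi k = 1" if "x \<in> sphere b r" for x
  proof -
    have "x \<notin> B \<union> X" using r that by auto
    then have 1: "(x - b) powi k = exp (h x)"
      using h[of x] that by (auto simp: G_def)
    have "exp (- h x / of_int k) powi k = exp (of_int k * (- h x / of_int k))"
      by (rule exp_power_int)
    also have "\<dots> = exp (- h x)" using \<open>k \<noteq> 0\<close> by simp
    finally show ?thesis by (simp add: w_def power_int_mult_distrib 1 exp_minus)
  qed
  have fin: "finite (w ` sphere b r)"
  proof -
    have "w x ^ nat \<bar>k\<bar> = 1" if "x \<in> sphere b r" for x
      using wk[OF that] by (auto simp: power_int_def power_inverse inverse_eq_1_iff split: if_splits)
    then have "w ` sphere b r \<subseteq> {z. z ^ nat \<bar>k\<bar> = 1}" by blast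
    moreover have "finite {z :: complex. z ^ nat \<bar>k\<bar> = 1}"
      using \<open>k \<noteq> 0\<close> by (intro finite_roots_unity) auto
    ultimately show ?thesis by (rule finite_subset)
  qed
  have "w constant_on sphere b r"
  proof (rule continuous_finite_range_constant[OF _ _ fin])
    show "connected (sphere b r)" by (simp add: connected_sphere)
    show "continuous_on (sphere b r) w"
      unfolding w_def using \<open>k \<noteq> 0\<close> by (intro continuous_intros continuous_on_subset[OF conth]) auto
  qed
  then obtain c where c: "\<And>x. x \<in> sphere b r \<Longrightarrow> w x = c" by (auto simp: constant_on_def)
  have "b + of_real r \<in> sphere b r" using \<open>r > 0\<close> by (simp add: dist_norm)
  then have "c \<noteq> 0" using wk c \<open>k \<noteq> 0\<close> by (metis power_int_0_left zero_neq_one)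
  obtain c' where c': "exp c' = c" using \<open>c \<noteq> 0\<close> exp_Ln by blast
  have log: "x - b = exp (c' + h x / of_int k)" if "x \<in> sphere b r" for x
    using c[OF that] c' by (simp add: w_def exp_add exp_minus field_simps)
  \<comment> \<open>A point outside the disc, so that \<open>x - d\<close> has a logarithm there.
    The quotient \<open>(x - b) / (x - d)\<close> then has one on the circle, and Borsuk's criterion
    would connect the centre with the outside.\<close>
  define d where "d = b + 2 * of_real r"
  have db: "dist b d = 2 * r" using \<open>r > 0\<close> by (simp add: d_def dist_norm norm_mult)
  have contd: "continuous_on (cball b r) (\<lambda>x. x - d)" by (intro continuous_intros)
  have "z - d \<noteq> 0" if "z \<in> cball b r" for z using that db \<open>r > 0\<close> by auto
  then obtain g where g: "continuous_on (cball b r) g" "\<And>x. x \<in> cball b r \<Longrightarrow> x - d = exp (g x)"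
    using continuous_logarithm_on_cball[OF contd] by blast
  have "connected_component (- sphere b r) b d"
  proof (subst connected_component_iff_continuous_logarithm)
    show "d \<notin> sphere b r" using db \<open>r > 0\<close> by auto
    have "continuous_on (sphere b r) (\<lambda>x. (c' + h x / of_int k) - g x)"
      using \<open>k \<noteq> 0\<close> by (intro continuous_intros continuous_on_subset[OF conth] continuous_on_subset[OF g(1)]) auto
    moreover have "(x - b) / (x - d) = exp ((c' + h x / of_int k) - g x)" if "x \<in> sphere b r" for x
      using log[OF that] g(2)[of x] that unfolding exp_diff by simp
    ultimately show "\<exists>g. continuous_on (sphere b r) g \<and> (\<forall>x\<in>sphere b r. (x - b) / (x - d) = exp (g x))"
      by blast
  qed (use bs in auto)
  then obtain C where C: "connected C" "C \<subseteq> - sphere b r" "b \<in> C" "d \<in> C"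
    by (auto simp: connected_component_def)
  have "C \<inter> frontier (ball b r) \<noteq> {}"
    by (rule connected_Int_frontier[OF C(1)]) (use C db \<open>r > 0\<close> in auto)
  then show False using C \<open>r > 0\<close> by auto
qed

text \<open>The constant difference \<open>z\<close> is a period of \<open>exp\<close>, so shifting
  \<open>h\<close> by it makes both logarithms agree on the overlap without changing their
  exponentials.\<close>

lemma continuous_logarithm_Un:
  assumes "compact S" "compact T" and contg: "continuous_on S g" and conth: "continuous_on T h"
    and const: "\<And>x. x \<in> S \<inter> T \<Longrightarrow> g x - h x = z"
    and eq: "\<And>x. x \<in> S \<inter> T \<Longrightarrow> exp (g x) = exp (h x)" and ne: "S \<inter> T \<noteq> {}"
  obtains l :: "complex \<Rightarrow> complex" where "continuous_on (S \<union> T) l"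
    "\<And>x. x \<in> S \<Longrightarrow> exp (l x) = exp (g x)" "\<And>x. x \<in> T \<Longrightarrow> exp (l x) = exp (h x)"
proof -
  have ez: "exp z = 1"
    using ne eq const by (metis all_not_in_conv exp_diff divide_self exp_not_eq_zero)
  show thesis
  proof
    show "continuous_on (S \<union> T) (\<lambda>x. if x \<in> S then g x else h x + z)"
      using assms(1-4) const
      by (intro continuous_on_cases compact_imp_closed continuous_intros) (auto simp: algebra_simps)
    show "exp (if x \<in> S then g x else h x + z) = exp (h x)" if "x \<in> T" for x
      using ez eq that by (auto simp: exp_add)
  qed auto
qed

text \<open>The part of \<open>H\<^sup>0(S \<inter> T)\<close> not coming from \<open>S\<close> or \<open>T\<close> has rank at most one, so by the
  Mayer-Vietoris sequence \<open>S \<union> T\<close> separates the points into at most two classes. Concretely: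
  logarithms on \<open>S\<close> and on \<open>T\<close> of \<open>(x - a) / (x - b)\<close> differ by multiples of \<open>2 pi i\<close>
  at \<open>p\<close> and \<open>q\<close>, and so do those of \<open>(x - a) / (x - c)\<close>; a product of powers of the two
  functions cancels the obstruction to glueing.\<close>

lemma connected_component_Un_two_points:
  fixes a b c :: complex
  assumes "compact S" "compact T" and pq: "S \<inter> T = {p, q}"
    and S: "connected_component (- S) a b" "connected_component (- S) a c"
    and T: "connected_component (- T) a b" "connected_component (- T) a c"
  shows "connected_component (- (S \<union> T)) a b \<or> connected_component (- (S \<union> T)) a c \<or>
    connected_component (- (S \<union> T)) b c"
proof (rule ccontr)
  let ?X = "S \<union> T"
  assume neg: "\<not> ?thesis"
  have notin: "a \<notin> S" "b \<notin> S" "c \<notin> S" "a \<notin> T" "b \<notin> T" "c \<notin> T"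
    using S T connected_component_in by (metis ComplD)+
  have "compact ?X" using assms by auto
  have ne: "S \<inter> T \<noteq> {}" using pq by auto
  have key: "\<exists>g h m. continuous_on S g \<and> continuous_on T h \<and> (\<forall>x\<in>S. (x - a) / (x - y) = exp (g x)) \<and>
      (\<forall>x\<in>T. (x - a) / (x - y) = exp (h x)) \<and> m \<noteq> 0 \<and>
      (g p - h p) - (g q - h q) = 2 * of_int m * pi * \<i>"
    if y: "connected_component (- S) a y" "connected_component (- T) a y"
      "\<not> connected_component (- ?X) a y" for y
  proof -
    have yn: "y \<notin> S" "y \<notin> T" using y connected_component_in by (metis ComplD)+
    obtain g where g: "continuous_on S g" "\<forall>x\<in>S. (x - a) / (x - y) = exp (g x)"
      using y notin yn assms connected_component_iff_continuous_logarithm[of S a y] by auto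
    obtain h where h: "continuous_on T h" "\<forall>x\<in>T. (x - a) / (x - y) = exp (h x)"
      using y notin yn assms connected_component_iff_continuous_logarithm[of T a y] by auto
    have ex: "\<exists>n. g x - h x = (of_int (2 * n) * pi) * \<i>" if "x \<in> S \<inter> T" for x
    proof -
      have "exp (g x) = exp (h x)" using g h that by (metis IntD1 IntD2)
      then show ?thesis unfolding exp_eq by (auto simp: algebra_simps)
    qed
    obtain n1 where n1: "g p - h p = (of_int (2 * n1) * pi) * \<i>" using ex pq by auto
    obtain n2 where n2: "g q - h q = (of_int (2 * n2) * pi) * \<i>" using ex pq by auto
    \<comment> \<open>With equal periods at \<open>p\<close> and \<open>q\<close> the logarithms
      could be glued, and Borsuk's criterion would connect \<open>a\<close> with
      \<open>y\<close>.\<close>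
    have "n1 - n2 \<noteq> 0"
    proof
      assume "n1 - n2 = 0"
      then have *: "g x - h x = g p - h p" if "x \<in> S \<inter> T" for x
        using n1 n2 pq that by auto
      obtain l where l: "continuous_on ?X l" "\<And>x. x \<in> S \<Longrightarrow> exp (l x) = exp (g x)"
         "\<And>x. x \<in> T \<Longrightarrow> exp (l x) = exp (h x)"
        by (rule continuous_logarithm_Un[OF assms(1,2) g(1) h(1) * _ ne]) (use g h in auto)
      have "connected_component (- ?X) a y"
        using connected_component_iff_continuous_logarithm[OF \<open>compact ?X\<close>, of a y] notin yn l g h by auto
      with y show False by simp
    qed
    moreover have "(g p - h p) - (g q - h q) = 2 * of_int (n1 - n2) * pi * \<i>"
      using n1 n2 by (simp add: algebra_simps)
    ultimately show ?thesis using g h by blast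
  qed
  obtain g h m where gh: "continuous_on S g" "continuous_on T h"
      "\<And>x. x \<in> S \<Longrightarrow> (x - a) / (x - b) = exp (g x)" "\<And>x. x \<in> T \<Longrightarrow> (x - a) / (x - b) = exp (h x)"
      "m \<noteq> 0" and m: "(g p - h p) - (g q - h q) = 2 * of_int m * pi * \<i>"
    using key[OF S(1) T(1)] neg by metis
  obtain g' h' k where gh': "continuous_on S g'" "continuous_on T h'"
      "\<And>x. x \<in> S \<Longrightarrow> (x - a) / (x - c) = exp (g' x)" "\<And>x. x \<in> T \<Longrightarrow> (x - a) / (x - c) = exp (h' x)"
      "k \<noteq> 0" and k: "(g' p - h' p) - (g' q - h' q) = 2 * of_int k * pi * \<i>"
    using key[OF S(2) T(2)] neg by metis
  define G where "G = (\<lambda>x. of_int k * g x - of_int m * g' x)"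
  define H where "H = (\<lambda>x. of_int k * h x - of_int m * h' x)"
  have GS: "exp (G x) = ((x - a) / (x - b)) powi k / ((x - a) / (x - c)) powi m" if "x \<in> S" for x
    using that gh gh' by (simp add: G_def exp_diff exp_power_int)
  have HT: "exp (H x) = ((x - a) / (x - b)) powi k / ((x - a) / (x - c)) powi m" if "x \<in> T" for x
    using that gh gh' by (simp add: H_def exp_diff exp_power_int)
  have "(G p - H p) - (G q - H q) = of_int k * ((g p - h p) - (g q - h q)) - of_int m * ((g' p - h' p) - (g' q - h' q))"
    by (simp add: G_def H_def algebra_simps)
  also have "\<dots> = 0" unfolding m k by (simp add: algebra_simps)
  finally have eq: "G x - H x = G p - H p" if "x \<in> S \<inter> T" for x using that pq by auto
  have contGH: "continuous_on S G" "continuous_on T H"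
    unfolding G_def H_def using gh gh' by (auto intro!: continuous_intros)
  have eqGH: "exp (G x) = exp (H x)" if "x \<in> S \<inter> T" for x using that GS HT by simp
  obtain l where l: "continuous_on ?X l" "\<And>x. x \<in> S \<Longrightarrow> exp (l x) = exp (G x)"
     "\<And>x. x \<in> T \<Longrightarrow> exp (l x) = exp (H x)"
    using continuous_logarithm_Un[OF assms(1,2) contGH eq eqGH ne] by blast
  have lX: "exp (l x) = ((x - a) / (x - b)) powi k / ((x - a) / (x - c)) powi m" if "x \<in> ?X" for x
    using that l(2,3) GS HT by auto
  \<comment> \<open>The same function with the power of \<open>x - b\<close>, respectively
    \<open>x - c\<close>, isolated: whichever of \<open>b\<close> and \<open>c\<close> lies in a
    bounded component carries the winding, and the other factors are zero-free on that
    component.\<close>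
  have lX': "exp (l x) = (x - b) powi (- k) * ((x - a) powi (k - m) * (x - c) powi m)"
    "exp (l x) = (x - c) powi m * ((x - a) powi (k - m) * (x - b) powi (- k))" if "x \<in> ?X" for x
  proof -
    have nz: "x \<noteq> a" "x \<noteq> b" "x \<noteq> c" using that notin by auto
    have "exp (l x) = (x - b) powi (- k) * ((x - a) powi (k - m) * (x - c) powi m)"
      unfolding lX[OF that] using nz
      by (simp add: power_int_divide_distrib power_int_diff power_int_minus field_simps)
    then show "exp (l x) = (x - b) powi (- k) * ((x - a) powi (k - m) * (x - c) powi m)"
      "exp (l x) = (x - c) powi m * ((x - a) powi (k - m) * (x - b) powi (- k))"
      by (simp_all add: mult_ac)
  qed
  have sym: "\<not> connected_component (- ?X) b a" "\<not> connected_component (- ?X) c a"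
      "\<not> connected_component (- ?X) c b"
    using neg connected_component_sym by blast+
  \<comment> \<open>The complement of a compact plane set has only one unbounded component, and
    \<open>b\<close> and \<open>c\<close> lie in different components.\<close>
  have "bounded (connected_component_set (- ?X) b) \<or> bounded (connected_component_set (- ?X) c)"
  proof (rule ccontr)
    assume n: "\<not> ?thesis"
    have "connected_component_set (- ?X) b = connected_component_set (- ?X) c"
      using n notin assms(1,2)
      by (intro cobounded_unique_unbounded_components[of "- ?X"]) (auto simp: compact_imp_bounded intro: componentsI)
    moreover have "c \<in> connected_component_set (- ?X) c" using notin by auto
    ultimately show False using neg by blast
  qed
  then show False
  proof
    assume bdd: "bounded (connected_component_set (- ?X) b)"
    have nD: "a \<notin> connected_component_set (- ?X) b \<union> ?X" "c \<notin> connected_component_set (- ?X) b \<union> ?X"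
      using neg sym notin by auto
    show False
    proof (rule no_logarithm_bounded_component[OF \<open>compact ?X\<close> _ bdd _ _ _ l(1) lX'(1)])
      show "continuous_on (connected_component_set (- ?X) b \<union> ?X) (\<lambda>x. (x - a) powi (k - m) * (x - c) powi m)"
        using nD by (intro continuous_intros) auto
      show "(x - a) powi (k - m) * (x - c) powi m \<noteq> 0" if "x \<in> connected_component_set (- ?X) b \<union> ?X" for x
        using nD that by auto
    qed (use notin \<open>k \<noteq> 0\<close> in auto)
  next
    assume bdd: "bounded (connected_component_set (- ?X) c)"
    have nD: "a \<notin> connected_component_set (- ?X) c \<union> ?X" "b \<notin> connected_component_set (- ?X) c \<union> ?X"
      using neg sym notin by auto
    show False
    proof (rule no_logarithm_bounded_component[OF \<open>compact ?X\<close> _ bdd _ _ _ l(1) lX'(2)])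
      show "continuous_on (connected_component_set (- ?X) c \<union> ?X) (\<lambda>x. (x - a) powi (k - m) * (x - b) powi (- k))"
        using nD by (intro continuous_intros) auto
      show "(x - a) powi (k - m) * (x - b) powi (- k) \<noteq> 0" if "x \<in> connected_component_set (- ?X) c \<union> ?X" for x
        using nD that by auto
    qed (use notin \<open>m \<noteq> 0\<close> in auto)
  qed
qed

text \<open>For an open arc \<open>A\<close> in \<open>X\<close> these are the faces lying along
  \<open>A\<close>. Closures replace any local model of the arc; one face may lie on both
  sides.\<close>

definition sides :: "complex set \<Rightarrow> complex set \<Rightarrow> complex set set" where
  "sides X A = {F \<in> components (- X). closure F \<inter> A \<noteq> {}}"

text \<open>The open arc lies in one component \<open>U\<close> of \<open>- S\<close>, and the
  others survive. Something of \<open>U\<close> remains, for otherwise the plane minus two points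
  would be disconnected; three pieces would contradict
  \<open>connected_component_Un_two_points\<close>; and if a path in \<open>S\<close> closes the arc
  to a Jordan curve, both sides of the curve accumulate at the arc and give two pieces.\<close>

lemma components_add_arc:
  assumes "compact S" "arc g" and pq: "S \<inter> path_image g = {pathstart g, pathfinish g}"
  defines "A \<equiv> path_image g - S" and "X \<equiv> S \<union> path_image g"
  obtains U where "U \<in> components (- S)"
    "components (- X) = (components (- S) - {U}) \<union> sides X A"
    "(components (- S) - {U}) \<inter> sides X A = {}"
    "sides X A \<noteq> {}" "finite (sides X A)" "card (sides X A) \<le> 2"
    "path_component S (pathstart g) (pathfinish g) \<Longrightarrow> card (sides X A) = 2"
proof -
  let ?e = "path_image g"
  have A: "A = ?e - {pathstart g, pathfinish g}" using pq by (auto simp: A_def)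
  have "simple_path g" using \<open>arc g\<close> by (rule arc_imp_simple_path)
  have "connected A" "A \<noteq> {}"
    unfolding A using \<open>simple_path g\<close> connected_simple_path_endless nonempty_simple_path_endless by blast+
  have "compact ?e" using \<open>arc g\<close> by (simp add: compact_arc_image)
  have "closed S" "closed ?e" "closed X"
    using \<open>compact S\<close> \<open>compact ?e\<close> by (auto simp: X_def compact_imp_closed)
  have X: "- X = - S - A" by (auto simp: X_def A_def)
  have XS: "- X \<subseteq> - S" by (auto simp: X_def)
  have "A \<subseteq> - S" by (auto simp: A_def)
  then obtain U where U: "U \<in> components (- S)" "A \<subseteq> U"
    using exists_component_superset[of A "- S"] \<open>connected A\<close> \<open>A \<noteq> {}\<close> by fastforce
  have "open U" using U(1) \<open>closed S\<close> by (meson open_Compl open_components)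
  have "connected U" using U(1) by (rule in_components_connected)
  have "connected (- ?e)" using \<open>arc g\<close> by (intro connected_arc_complement) auto
  define N where "N = {F \<in> components (- X). F \<subseteq> U}"
  have opF: "open F" if "F \<in> components (- X)" for F
    using that \<open>closed X\<close> by (meson open_Compl open_components)
  have FU: "F \<in> N" if "F \<in> components (- X)" "F \<inter> U \<noteq> {}" for F
    using that components_maximal[OF U(1), of F] XS in_components_connected[of F "- X"]
      in_components_subset[of F "- X"] by (auto simp: N_def)
  have old: "C \<in> components (- X)" if "C \<in> components (- S)" "C \<noteq> U" for C
  proof (rule components_intermediate_subset[OF that(1) _ XS])
    have "C \<inter> U = {}" using that U by (metis components_eq)
    then show "C \<subseteq> - X" using U(2) in_components_subset[OF that(1)] by (auto simp: X)
  qed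
  have comps: "components (- X) = (components (- S) - {U}) \<union> N"
  proof
    show "components (- X) \<subseteq> (components (- S) - {U}) \<union> N"
    proof
      fix F assume F: "F \<in> components (- X)"
      show "F \<in> (components (- S) - {U}) \<union> N"
      proof (cases "F \<inter> U = {}")
        case False then show ?thesis using FU F by blast
      next
        case True
        have "F \<subseteq> - S" "F \<noteq> {}" "connected F"
          using F in_components_subset XS in_components_nonempty in_components_connected by blast+
        then obtain C where C: "C \<in> components (- S)" "F \<subseteq> C"
          using exists_component_superset[of F "- S"] by fastforce
        then have "C \<noteq> U" using True \<open>F \<noteq> {}\<close> by auto
        then have "C = F" using old C F components_eq[of C "- X" F] \<open>F \<noteq> {}\<close> by auto
        then show ?thesis using C \<open>C \<noteq> U\<close> by auto
      qed
    qed
  qed (use old N_def in auto)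
  have disj: "(components (- S) - {U}) \<inter> N = {}"
  proof -
    have False if "C \<in> components (- S)" "C \<noteq> U" "C \<subseteq> U" for C
      using that components_eq[OF that(1) U(1)] in_components_nonempty[OF that(1)] by auto
    then show ?thesis by (auto simp: N_def)
  qed
  have N: "N = sides X A"
  proof
    show "N \<subseteq> sides X A"
    proof
      fix F assume F: "F \<in> N"
      then have F': "F \<in> components (- X)" "F \<subseteq> U" by (auto simp: N_def)
      have "F \<noteq> {}" using F' in_components_nonempty by blast
      have "closure F \<inter> A \<noteq> {}"
      \<comment> \<open>A piece of \<open>U\<close> whose closure avoids the open arc would be
        clopen in \<open>U\<close>, hence equal to \<open>U\<close>, which contains the arc.\<close>
      proof
        assume e: "closure F \<inter> A = {}"
        have "closure F \<inter> U \<subseteq> F"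
        proof
          fix x assume x: "x \<in> closure F \<inter> U"
          then have "x \<in> - X" using e in_components_subset[OF U(1)] by (auto simp: X)
          then obtain F2 where F2: "F2 \<in> components (- X)" "x \<in> F2" by (metis UnionE Union_components)
          then have "F2 \<inter> F \<noteq> {}" using x opF[of F2] by (metis IntD1 disjoint_iff open_Int_closure_eq_empty)
          then show "x \<in> F" using F2 F' components_eq by metis
        qed
        then have FcU: "F = U \<inter> closure F" using F' closure_subset by blast
        have "closedin (top_of_set U) F" by (subst FcU) (simp add: closedin_closed_Int)
        moreover have "openin (top_of_set U) F"
          using F' opF \<open>open U\<close> by (simp add: openin_open_eq)
        ultimately have "F = U" using \<open>connected U\<close> \<open>F \<noteq> {}\<close> by (auto simp: connected_clopen)
        then show False using U(2) \<open>A \<noteq> {}\<close> in_components_subset[OF F'(1)] by (auto simp: X)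
      qed
      then show "F \<in> sides X A" using F' by (simp add: sides_def)
    qed
    show "sides X A \<subseteq> N"
    proof
      fix F assume F: "F \<in> sides X A"
      then have "closure F \<inter> U \<noteq> {}" using U(2) by (auto simp: sides_def)
      then have "F \<inter> U \<noteq> {}" using \<open>open U\<close> by (metis open_Int_closure_eq_empty Int_commute)
      then show "F \<in> N" using FU F by (simp add: sides_def)
    qed
  qed
  have "N \<noteq> {}"
  proof
    assume "N = {}"
    have "U \<subseteq> A"
    proof
      fix x assume "x \<in> U"
      show "x \<in> A"
      proof (rule ccontr)
        assume "x \<notin> A"
        then have "x \<in> - X" using \<open>x \<in> U\<close> in_components_subset[OF U(1)] by (auto simp: X)
        then obtain F where "F \<in> components (- X)" "x \<in> F" by (metis UnionE Union_components)
        then show False using FU \<open>x \<in> U\<close> \<open>N = {}\<close> by blast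
      qed
    qed
    then have "U = A" using U by auto
    have "connected (UNIV - {pathstart g, pathfinish g})"
      by (intro connected_open_diff_countable) auto
    moreover have "UNIV - {pathstart g, pathfinish g} = U \<union> (- ?e)"
      unfolding \<open>U = A\<close> A by auto
    moreover have "open (- ?e)" using \<open>closed ?e\<close> by auto
    moreover have "- ?e \<noteq> {}"
    proof
      assume "- ?e = {}"
      then have "?e = UNIV" by auto
      then show False using \<open>compact ?e\<close> compact_imp_bounded not_bounded_UNIV by metis
    qed
    moreover have "U \<noteq> {}" "U \<inter> - ?e = {}" using \<open>A \<noteq> {}\<close> \<open>U = A\<close> A by auto
    ultimately show False using \<open>open U\<close> connectedD[of "U \<union> - ?e" U "- ?e"] by auto
  qed
  have "\<exists>F1 F2. N \<subseteq> {F1, F2}"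
  proof (rule ccontr)
    assume neg: "\<not> ?thesis"
    obtain F1 where F1: "F1 \<in> N" using \<open>N \<noteq> {}\<close> by auto
    obtain F2 where F2: "F2 \<in> N" "F2 \<noteq> F1" using neg by blast
    obtain F3 where F3: "F3 \<in> N" "F3 \<noteq> F1" "F3 \<noteq> F2" using neg by blast
    obtain a b c where abc: "a \<in> F1" "b \<in> F2" "c \<in> F3"
      using F1 F2 F3 in_components_nonempty unfolding N_def by blast
    have nc: "\<not> connected_component (- X) x y" if "x \<in> F" "y \<in> F'" "F \<in> N" "F' \<in> N" "F \<noteq> F'" for x y F F'
    proof
      assume "connected_component (- X) x y"
      then obtain T where T: "connected T" "T \<subseteq> - X" "x \<in> T" "y \<in> T" by (auto simp: connected_component_def)
      then have "T \<subseteq> F" "T \<subseteq> F'"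
        using that components_maximal[of F "- X" T] components_maximal[of F' "- X" T] by (auto simp: N_def)
      then have "F \<inter> F' \<noteq> {}" using T by auto
      then show False using that components_eq[of F "- X" F'] by (auto simp: N_def)
    qed
    have abcU: "a \<in> U" "b \<in> U" "c \<in> U" using abc F1 F2 F3 by (auto simp: N_def)
    have abce: "a \<in> - ?e" "b \<in> - ?e" "c \<in> - ?e"
      using abc F1 F2 F3 in_components_subset[of _ "- X"] by (auto simp: N_def X_def)
    have 1: "connected_component (- S) x y" if "x \<in> U" "y \<in> U" for x y
      using that \<open>connected U\<close> in_components_subset[OF U(1)] unfolding connected_component_def by blast
    have 2: "connected_component (- ?e) x y" if "x \<in> - ?e" "y \<in> - ?e" for x y
      using that \<open>connected (- ?e)\<close> unfolding connected_component_def by blast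
    show False
      using connected_component_Un_two_points[OF \<open>compact S\<close> \<open>compact ?e\<close> pq 1 1 2 2, of a b c]
        abcU abce nc[of a F1 b F2] nc[of a F1 c F3] nc[of b F2 c F3] F1 F2 F3 abc
      unfolding X_def by blast
  qed
  then obtain F1 F2 where "N \<subseteq> {F1, F2}" by blast
  then have finN: "finite N" and cardN: "card N \<le> 2"
    using card_mono[of "{F1, F2}" N] by (auto intro: finite_subset simp: card_insert_if split: if_splits)
  have "card N = 2" if pc: "path_component S (pathstart g) (pathfinish g)"
  proof -
    obtain f where "path f" "path_image f \<subseteq> S" "pathstart f = pathfinish g" "pathfinish f = pathstart g"
      using path_component_sym[OF pc] by (auto simp: path_component_def)
    moreover have "pathfinish g \<noteq> pathstart g" using \<open>arc g\<close> arc_distinct_ends by metis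
    ultimately obtain h where h: "arc h" "path_image h \<subseteq> S" "pathstart h = pathfinish g" "pathfinish h = pathstart g"
      using path_contains_arc[of f "pathfinish g" "pathstart g"] by (metis order_trans)
    have sp: "simple_path (g +++ h)"
      using h pq by (intro simple_path_join_loop \<open>arc g\<close>) auto
    have loop: "pathfinish (g +++ h) = pathstart (g +++ h)" using h by simp
    have pi: "path_image (g +++ h) = ?e \<union> path_image h" using h by (simp add: path_image_join)
    obtain inner outer where io: "open inner" "open outer" "inner \<inter> outer = {}"
       "inner \<union> outer = - path_image (g +++ h)"
       "frontier inner = path_image (g +++ h)" "frontier outer = path_image (g +++ h)"
      by (rule Jordan_curve[OF sp loop]) metis
    obtain x where "x \<in> A" using \<open>A \<noteq> {}\<close> by auto
    then have "x \<in> U" "x \<in> closure inner" "x \<in> closure outer"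
      using U(2) io pi by (auto simp: frontier_def A_def)
    then have "U \<inter> inner \<noteq> {}" "U \<inter> outer \<noteq> {}"
      using \<open>open U\<close> by (metis IntI empty_iff open_Int_closure_eq_empty)+
    then obtain y z where yz: "y \<in> U" "y \<in> inner" "z \<in> U" "z \<in> outer" by auto
    then have "y \<notin> A" "z \<notin> A" using io pi by (auto simp: A_def)
    then have "y \<in> - X" "z \<in> - X" using yz in_components_subset[OF U(1)] by (auto simp: X)
    then obtain F1 F2 where F: "F1 \<in> components (- X)" "y \<in> F1" "F2 \<in> components (- X)" "z \<in> F2"
      by (metis UnionE Union_components)
    have "F1 \<noteq> F2"
    proof
      assume "F1 = F2"
      have "F1 \<subseteq> inner \<union> outer"
        using in_components_subset[OF F(1)] h(2) io pi by (auto simp: X_def)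
      moreover have "inner \<inter> outer \<inter> F1 = {}" using io by auto
      moreover have "inner \<inter> F1 \<noteq> {}" "outer \<inter> F1 \<noteq> {}" using F yz \<open>F1 = F2\<close> by auto
      ultimately show False
        using connectedD[OF in_components_connected[OF F(1)] io(1,2)] by blast
    qed
    moreover have "F1 \<in> N" "F2 \<in> N" using FU F yz by auto
    ultimately have "card {F1, F2} \<le> card N" using finN by (intro card_mono) auto
    then show ?thesis using cardN \<open>F1 \<noteq> F2\<close> by simp
  qed
  then show ?thesis
    using that[OF U(1)] comps disj \<open>N \<noteq> {}\<close> finN cardN unfolding N by blast
qed

section \<open>Plane graphs\<close>

locale plane_graph =
  fixes V :: "complex set" and E :: "complex set set"
  assumes finite_V: "finite V" and finite_E: "finite E"
    and edge_arc: "e \<in> E \<Longrightarrow> \<exists>g. arc g \<and> path_image g = e \<and> e \<inter> V = {pathstart g, pathfinish g}"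
    and edges_meet: "e \<in> E \<Longrightarrow> e' \<in> E \<Longrightarrow> e \<noteq> e' \<Longrightarrow> e \<inter> e' \<subseteq> V"
begin

abbreviation "drawing \<equiv> V \<union> \<Union>E"
abbreviation "faces \<equiv> components (- drawing)"
abbreviation "edge_sides e \<equiv> sides drawing (e - V)"

lemma plane_graph_subset: "E' \<subseteq> E \<Longrightarrow> plane_graph V E'"
proof
  assume "E' \<subseteq> E"
  then show "finite E'" using finite_E finite_subset by blast
  show "e \<inter> e' \<subseteq> V" if "e \<in> E'" "e' \<in> E'" "e \<noteq> e'" for e e'
    using that \<open>E' \<subseteq> E\<close> by (intro edges_meet) auto
qed (use finite_V edge_arc in \<open>auto dest: subsetD\<close>)

lemma compact_edge: "e \<in> E \<Longrightarrow> compact e"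
  using edge_arc compact_arc_image by metis

lemma compact_Union_edges: "E' \<subseteq> E \<Longrightarrow> compact (\<Union>E')"
proof (rule compact_Union)
  assume "E' \<subseteq> E"
  then show "finite E'" using finite_E finite_subset by blast
qed (use compact_edge in auto)

lemma compact_drawing: "compact drawing"
  using compact_Union_edges[of E] finite_imp_compact[OF finite_V] by (simp add: compact_Un)

lemma connected_Compl_edge: "e \<in> E \<Longrightarrow> connected (- e)"
  using edge_arc connected_arc_complement by fastforce

lemma edge_add:
  assumes "e \<in> E"
  defines "S \<equiv> V \<union> \<Union>(E - {e})"
  obtains U where "U \<in> components (- S)"
    "faces = (components (- S) - {U}) \<union> edge_sides e"
    "(components (- S) - {U}) \<inter> edge_sides e = {}"
    "edge_sides e \<noteq> {}" "finite (edge_sides e)" "card (edge_sides e) \<le> 2"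
    "\<And>x y. e \<inter> V = {x, y} \<Longrightarrow> path_component S x y \<Longrightarrow> card (edge_sides e) = 2"
proof -
  obtain g where g: "arc g" "path_image g = e" "e \<inter> V = {pathstart g, pathfinish g}"
    using edge_arc[OF assms(1)] by auto
  have "S \<inter> e = e \<inter> V"
    using edges_meet[OF assms(1)] unfolding S_def by blast
  then have pq: "S \<inter> path_image g = {pathstart g, pathfinish g}" using g by simp
  have "compact S"
    unfolding S_def using compact_Union_edges[of "E - {e}"] finite_V by (auto intro: finite_imp_compact)
  have eq: "path_image g - S = e - V" "S \<union> path_image g = drawing"
    using g \<open>S \<inter> e = e \<inter> V\<close> assms by auto
  show thesis
  proof (rule components_add_arc[OF \<open>compact S\<close> g(1) pq, unfolded eq])
    fix U
    assume U: "U \<in> components (- S)"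
      "faces = (components (- S) - {U}) \<union> edge_sides e"
      "(components (- S) - {U}) \<inter> edge_sides e = {}"
      "edge_sides e \<noteq> {}" "finite (edge_sides e)" "card (edge_sides e) \<le> 2"
      and two: "path_component S (pathstart g) (pathfinish g) \<Longrightarrow> card (edge_sides e) = 2"
    have "card (edge_sides e) = 2" if "e \<inter> V = {x, y}" "path_component S x y" for x y
    proof -
      have "{x, y} = {pathstart g, pathfinish g}" using that g by simp
      then have "path_component S (pathstart g) (pathfinish g)"
        using that(2) path_component_sym by (auto simp: doubleton_eq_iff)
      then show ?thesis by (rule two)
    qed
    with U show thesis by (rule that)
  qed
qed

text \<open>Path components are counted because a path between the ends of a new edge is what closes
  it to a Jordan curve.\<close>

definition vertex_components :: nat where
  "vertex_components = card ((\<lambda>v. path_component_set drawing v) ` V)"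

end

section \<open>Euler's inequality\<close>

lemma card_image_coarser:
  assumes "finite V" and coarser: "\<And>x y. x \<in> V \<Longrightarrow> y \<in> V \<Longrightarrow> f x = f y \<Longrightarrow> h x = h y"
  shows "card (h ` V) \<le> card (f ` V)"
    and "x \<in> V \<Longrightarrow> y \<in> V \<Longrightarrow> f x \<noteq> f y \<Longrightarrow> h x = h y \<Longrightarrow> card (h ` V) < card (f ` V)"
proof -
  define r where "r = (\<lambda>c. h (SOME v. v \<in> V \<and> f v = c))"
  have r: "r (f x) = h x" if "x \<in> V" for x
  proof -
    have "(SOME v. v \<in> V \<and> f v = f x) \<in> V \<and> f (SOME v. v \<in> V \<and> f v = f x) = f x"
      using that by (intro someI[of "\<lambda>v. v \<in> V \<and> f v = f x" x]) auto
    then show ?thesis unfolding r_def using coarser that by metis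
  qed
  then have im: "h ` V = r ` (f ` V)" by (auto simp: image_iff)
  show le: "card (h ` V) \<le> card (f ` V)"
    unfolding im using assms(1) by (intro card_image_le) auto
  show "card (h ` V) < card (f ` V)" if "x \<in> V" "y \<in> V" "f x \<noteq> f y" "h x = h y"
  proof -
    have "\<not> inj_on r (f ` V)" using that r unfolding inj_on_def by (metis imageI)
    then show ?thesis using le im assms(1) by (metis eq_card_imp_inj_on finite_imageI le_neq_implies_less)
  qed
qed

text \<open>A new edge whose ends are already joined creates one face and no vertex component. Any
  other new edge merges two vertex components and loses no face. Both changes preserve the
  inequality.\<close>

theorem Euler_inequality:
  assumes "plane_graph V E"
  shows "finite (components (- (V \<union> \<Union>E))) \<and>
    card E + 1 + plane_graph.vertex_components V E \<le> card (components (- (V \<union> \<Union>E))) + card V"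
proof -
  have "finite E" using assms by (rule plane_graph.finite_E)
  then show ?thesis using assms
  proof (induction E rule: finite_induct)
    case empty
    interpret plane_graph V "{}" by fact
    have "connected (UNIV - V)"
      using finite_V by (intro connected_open_diff_countable) (auto intro: countable_finite)
    moreover have "UNIV - V \<noteq> {}" using finite_V by (metis Diff_eq_empty_iff infinite_UNIV_char_0 rev_finite_subset)
    ultimately have "components (- V) = {- V}"
      by (simp add: Compl_eq_Diff_UNIV components_eq_sing_iff)
    then show ?case
      using finite_V card_image_le[of V] by (simp add: vertex_components_def)
  next
    case (insert e E)
    interpret G: plane_graph V "insert e E" by fact
    interpret H: plane_graph V E using G.plane_graph_subset by blast
    have eE: "insert e E - {e} = E" using insert.hyps by auto
    obtain U where U: "U \<in> H.faces" "G.faces = (H.faces - {U}) \<union> G.edge_sides e"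
      "(H.faces - {U}) \<inter> G.edge_sides e = {}" "G.edge_sides e \<noteq> {}" "finite (G.edge_sides e)"
      "card (G.edge_sides e) \<le> 2"
      "\<And>x y. e \<inter> V = {x, y} \<Longrightarrow> path_component H.drawing x y \<Longrightarrow> card (G.edge_sides e) = 2"
      by (rule G.edge_add[of e, unfolded eE]) blast+
    have IH: "finite H.faces" "card E + 1 + H.vertex_components \<le> card H.faces + card V"
      using insert.IH H.plane_graph_axioms by auto
    have "finite G.faces" using IH U by auto
    have "card G.faces = card (H.faces - {U}) + card (G.edge_sides e)"
      unfolding U(2) using U IH by (intro card_Un_disjoint) auto
    moreover have "card (H.faces - {U}) = card H.faces - 1" using U(1) by simp
    moreover have "card H.faces \<ge> 1" using U(1) IH(1) by (metis One_nat_def Suc_leI card_gt_0_iff empty_iff)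
    moreover have "card (G.edge_sides e) \<ge> 1" using U(4,5) by (metis One_nat_def Suc_leI card_gt_0_iff)
    ultimately have f: "card G.faces + 1 = card H.faces + card (G.edge_sides e)" "card G.faces \<ge> card H.faces"
      by linarith+
    obtain g where g: "arc g" "path_image g = e" "e \<inter> V = {pathstart g, pathfinish g}"
      using G.edge_arc by blast
    let ?p = "pathstart g" and ?q = "pathfinish g"
    have pq: "?p \<in> V" "?q \<in> V" using g by auto
    have mono: "path_component_set G.drawing x = path_component_set G.drawing y"
      if "x \<in> V" "y \<in> V" "path_component_set H.drawing x = path_component_set H.drawing y" for x y
    proof -
      have "path_component H.drawing x y" using that path_component_refl[of y] by auto
      then have "path_component G.drawing x y" by (rule path_component_of_subset[rotated]) auto
      then show ?thesis by (simp add: path_component_eq)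
    qed
    have "path_component G.drawing ?p ?q"
      unfolding path_component_def using g arc_imp_path by (intro exI[of _ g]) auto
    then have eqpq: "path_component_set G.drawing ?p = path_component_set G.drawing ?q"
      by (simp add: path_component_eq)
    show ?case
    proof (cases "path_component H.drawing ?p ?q")
      case True
      then have "card (G.edge_sides e) = 2" using U(7) g by blast
      moreover have "G.vertex_components \<le> H.vertex_components"
        unfolding G.vertex_components_def H.vertex_components_def
        using mono G.finite_V by (rule card_image_coarser(1)[rotated])
      ultimately show ?thesis using f IH \<open>finite G.faces\<close> insert.hyps by simp
    next
      case False
      then have "path_component_set H.drawing ?p \<noteq> path_component_set H.drawing ?q"
        using pq path_component_refl[of ?q] by auto
      then have "G.vertex_components < H.vertex_components"
        unfolding G.vertex_components_def H.vertex_components_def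
        using card_image_coarser(2)[of V "path_component_set H.drawing" "path_component_set G.drawing" ?p ?q]
          mono G.finite_V pq eqpq by blast
      then show ?thesis using f IH \<open>finite G.faces\<close> insert.hyps by simp
    qed
  qed
qed

section \<open>Face boundaries and the edge bound\<close>

context plane_graph begin

lemma finite_faces: "finite faces"
  using Euler_inequality plane_graph_axioms by blast

text \<open>An edge with \<open>F\<close> on both sides has \<open>edge_sides e = {F}\<close> and is
  left out, since it separates \<open>F\<close> from no other face.\<close>

definition boundary :: "complex set \<Rightarrow> complex set set" where
  "boundary F = {e \<in> E. F \<in> edge_sides e \<and> card (edge_sides e) = 2}"

text \<open>Enlarge \<open>F\<close> by the open edges whose only side is \<open>F\<close>. This set
  \<open>F'\<close> and the rest of the complement of \<open>?Y\<close> are both open and nonempty,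
  the rest because it contains \<open>F2\<close>. Including the vertices in \<open>?Y\<close> is
  harmless, as finitely many points do not disconnect a connected open plane set.\<close>

lemma boundary_separates:
  assumes F: "F \<in> faces" and F2: "F2 \<in> faces" "F2 \<noteq> F"
  shows "\<not> connected (- \<Union>(boundary F))"
proof
  let ?b = "boundary F" and ?Y = "V \<union> \<Union>(boundary F)"
  assume conn: "connected (- \<Union>?b)"
  have clX: "closed drawing" using compact_drawing compact_imp_closed by blast
  have opF: "open C" if "C \<in> faces" for C using that clX by (meson open_Compl open_components)
  have bE: "?b \<subseteq> E" by (auto simp: boundary_def)
  have "closed (\<Union>?b)" using compact_Union_edges[OF bE] compact_imp_closed by blast
  then have "connected (- \<Union>?b - V)"
    using conn finite_V by (intro connected_open_diff_countable) (auto intro: countable_finite)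
  moreover have "- \<Union>?b - V = - ?Y" by auto
  ultimately have conY: "connected (- ?Y)" by simp
  define D where "D = {e \<in> E. edge_sides e = {F}}"
  define F' where "F' = F \<union> (\<Union>e\<in>D. e - V)"
  have clV: "closed V" using finite_V by (simp add: finite_imp_closed)
  have clE: "closed (\<Union>(E - {e}))" for e
    using compact_Union_edges[of "E - {e}"] compact_imp_closed by blast
  have FX: "F \<inter> drawing = {}" using in_components_subset[OF F] by auto
  have face: "\<exists>C. C \<in> faces \<and> x \<in> C" if "x \<notin> drawing" for x
    using that by (metis ComplI UnionE Union_components)
  have open_F': "open F'"
  proof (subst open_subopen, intro ballI)
    fix x assume x: "x \<in> F'"
    show "\<exists>T. open T \<and> x \<in> T \<and> T \<subseteq> F'"
    proof (cases "x \<in> F")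
      case True then show ?thesis using opF F unfolding F'_def by blast
    next
      case False
      then obtain e where e: "e \<in> D" "x \<in> e - V" using x by (auto simp: F'_def)
      \<comment> \<open>Near an inner point of an edge with \<open>F\<close> as its only side,
        nothing but that edge and \<open>F\<close> is found.\<close>
      define T where "T = - (V \<union> \<Union>(E - {e}) \<union> \<Union>(closure ` (faces - {F})))"
      have "closed (\<Union>(closure ` (faces - {F})))"
        using finite_faces by (intro closed_Union) auto
      then have "open T" unfolding T_def
        using clV clE[of e] by (intro open_Compl closed_Un)
      moreover have "x \<in> T"
      proof -
        have "x \<notin> \<Union>(E - {e})" using e edges_meet[of e] by (auto simp: D_def)
        moreover have "x \<notin> closure C" if "C \<in> faces - {F}" for C
        proof
          assume "x \<in> closure C"
          then have "C \<in> edge_sides e" using that e(2) by (auto simp: sides_def)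
          then show False using e(1) that by (auto simp: D_def)
        qed
        ultimately show ?thesis using e(2) by (auto simp: T_def)
      qed
      moreover have "T \<subseteq> F'"
      proof
        fix y assume y: "y \<in> T"
        show "y \<in> F'"
        proof (cases "y \<in> e")
          case True then show ?thesis using y e(1) by (auto simp: T_def F'_def)
        next
          case n: False
          then have "y \<notin> drawing" using y by (auto simp: T_def)
          then obtain C where C: "C \<in> faces" "y \<in> C" using face by blast
          then have "C = F" using y closure_subset[of C] by (auto simp: T_def)
          then show ?thesis using C by (simp add: F'_def)
        qed
      qed
      ultimately show ?thesis by blast
    qed
  qed
  have open_rest: "open (- ?Y - F')"
  proof (subst open_subopen, intro ballI)
    fix x assume x: "x \<in> - ?Y - F'"
    show "\<exists>T. open T \<and> x \<in> T \<and> T \<subseteq> - ?Y - F'"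
    proof (cases "x \<in> drawing")
      case False
      then obtain C where C: "C \<in> faces" "x \<in> C" using face by blast
      then have "C \<noteq> F" using x by (auto simp: F'_def)
      then have "C \<inter> F = {}" using C F components_eq by blast
      moreover have "C \<inter> drawing = {}" using in_components_subset[OF C(1)] by auto
      ultimately have "C \<subseteq> - ?Y - F'" using bE by (auto simp: F'_def D_def)
      then show ?thesis using C opF by blast
    next
      case True
      then obtain e where e: "e \<in> E" "x \<in> e - V" using x by auto
      have "e \<notin> ?b" "e \<notin> D" using e x by (auto simp: F'_def)
      have "finite (edge_sides e)" "card (edge_sides e) \<le> 2" using edge_add[OF e(1)] by metis+
      have "F \<notin> edge_sides e"
      proof
        assume *: "F \<in> edge_sides e"
        then have "card (edge_sides e) \<noteq> 0" using \<open>finite (edge_sides e)\<close> by auto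
        moreover have "card (edge_sides e) \<noteq> 2" using * e(1) \<open>e \<notin> ?b\<close> by (auto simp: boundary_def)
        ultimately have "card (edge_sides e) = 1" using \<open>card (edge_sides e) \<le> 2\<close> by linarith
        then have "edge_sides e = {F}" using * by (metis card_1_singletonE singletonD)
        then show False using \<open>e \<notin> D\<close> e(1) by (auto simp: D_def)
      qed
      then have xF: "x \<notin> closure F" using e F by (auto simp: sides_def)
      \<comment> \<open>An edge outside \<open>?b\<close> and \<open>D\<close> does not have
        \<open>F\<close> as a side, so a neighbourhood of \<open>x\<close> can avoid the closure of
        \<open>F\<close> and all other edges, and with them \<open>F'\<close>.\<close>
      define T where "T = - (V \<union> \<Union>(E - {e}) \<union> closure F)"
      have "open T" unfolding T_def using clV clE by auto
      moreover have "x \<in> T" using xF e edges_meet[OF e(1)] by (auto simp: T_def)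
      moreover have "T \<subseteq> - ?Y - F'"
      proof -
        have "T \<inter> e' = {}" if "e' \<in> ?b \<or> e' \<in> D" for e'
          using that \<open>e \<notin> ?b\<close> \<open>e \<notin> D\<close> bE by (auto simp: T_def D_def)
        then show ?thesis using closure_subset[of F] by (auto simp: T_def F'_def)
      qed
      ultimately show ?thesis by blast
    qed
  qed
  have F'Y: "F' \<subseteq> - ?Y"
  proof
    fix x assume x: "x \<in> F'"
    show "x \<in> - ?Y"
    proof (cases "x \<in> F")
      case True then show ?thesis using FX bE by auto
    next
      case False
      then obtain e where e: "e \<in> D" "x \<in> e - V" using x by (auto simp: F'_def)
      have "x \<notin> e'" if "e' \<in> ?b" for e'
      proof
        assume "x \<in> e'"
        have "e' \<noteq> e" using e(1) that by (auto simp: D_def boundary_def)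
        then show False using edges_meet[of e e'] e that \<open>x \<in> e'\<close> by (auto simp: D_def boundary_def)
      qed
      then show ?thesis using e by auto
    qed
  qed
  have "F' \<noteq> {}" using in_components_nonempty[OF F] by (auto simp: F'_def)
  have F2d: "F2 \<inter> F = {}" "F2 \<inter> drawing = {}" "F2 \<noteq> {}"
    using F2 F components_eq in_components_subset[OF F2(1)] in_components_nonempty[OF F2(1)] by blast+
  then have "F2 \<subseteq> - ?Y - F'" using bE by (auto simp: F'_def D_def)
  then have "- ?Y - F' \<noteq> {}" using F2d(3) by blast
  have "F' \<inter> (- ?Y - F') \<inter> - ?Y = {}" "- ?Y \<subseteq> F' \<union> (- ?Y - F')" by blast+
  then have "F' \<inter> - ?Y = {} \<or> (- ?Y - F') \<inter> - ?Y = {}"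
    using connectedD[OF conY open_F' open_rest] by blast
  then show False using F'Y \<open>F' \<noteq> {}\<close> \<open>- ?Y - F' \<noteq> {}\<close> by blast
qed

text \<open>An edge with an end that meets no other edge can be removed without connecting the
  complement.\<close>

lemma separating_edges:
  assumes "b \<subseteq> E" "\<not> connected (- \<Union>b)"
  shows "\<exists>b'\<subseteq>b. b' \<noteq> {} \<and> (\<forall>v\<in>V. card {e \<in> b'. v \<in> e} \<noteq> 1)"
proof -
  have "finite b" using assms(1) finite_E finite_subset by blast
  then show ?thesis using assms
  proof (induction b rule: finite_psubset_induct)
    case (psubset b)
    have "b \<noteq> {}" using psubset.prems(2) by auto
    show ?case
    proof (cases "\<forall>v\<in>V. card {e \<in> b. v \<in> e} \<noteq> 1")
      case True then show ?thesis using \<open>b \<noteq> {}\<close> by blast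
    next
      case False
      then obtain v where v: "v \<in> V" "card {e \<in> b. v \<in> e} = 1" by auto
      then obtain e where e: "{e \<in> b. v \<in> e} = {e}" by (metis card_1_singletonE)
      define c where "c = b - {e}"
      have eb: "e \<in> b" "v \<in> e" using e by auto
      have "b = insert e c" using eb by (auto simp: c_def)
      have cE: "c \<subseteq> E" "e \<in> E" using psubset.prems(1) eb by (auto simp: c_def)
      obtain g where g: "e \<inter> V = {pathstart g, pathfinish g}" using edge_arc[OF cE(2)] by blast
      have "v = pathstart g \<or> v = pathfinish g" using g v(1) eb(2) by blast
      then obtain w where w: "e \<inter> V = {v, w}" using g by (metis insert_commute)
      have "\<Union>c \<inter> e \<subseteq> {w}"
      proof
        fix x assume x: "x \<in> \<Union>c \<inter> e"
        then obtain e' where e': "e' \<in> b" "e' \<noteq> e" "x \<in> e'" by (auto simp: c_def)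
        then have "x \<noteq> v" using e by auto
        moreover have "x \<in> V"
          using edges_meet[of e' e] e' psubset.prems(1) cE(2) x by (meson IntD2 IntI subsetD)
        ultimately show "x \<in> {w}" using w x by auto
      qed
      then have "connected (\<Union>c \<inter> e)" by (auto simp: subset_singleton_iff)
      moreover have "compact (\<Union>c)" by (rule compact_Union_edges[OF cE(1)])
      moreover have "closed e" by (rule compact_imp_closed[OF compact_edge[OF cE(2)]])
      moreover have "\<not> connected (- (\<Union>c \<union> e))"
        using psubset.prems(2) \<open>b = insert e c\<close> by (simp add: Un_commute)
      \<comment> \<open>Janiszewski: two sets that do not separate the plane and have a connected
        intersection do not separate it together. Here the intersection is at most the point
        \<open>w\<close>, and an arc never separates.\<close>
      ultimately have "\<not> connected (- \<Union>c)"
        using Janiszewski_connected[of "\<Union>c" e] connected_Compl_edge[OF cE(2)] by blast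
      moreover have "c \<subset> b" using eb by (auto simp: c_def)
      ultimately have "\<exists>b'\<subseteq>c. b' \<noteq> {} \<and> (\<forall>v\<in>V. card {e \<in> b'. v \<in> e} \<noteq> 1)"
        using psubset.IH[of c] cE(1) by simp
      then show ?thesis using \<open>c \<subset> b\<close> by (meson order_trans psubset_imp_subset)
    qed
  qed
qed

text \<open>The girth hypothesis speaks of edge sets without vertices of degree one, the form in
  which \<open>separating_edges\<close> delivers them, so no cycle is traced in the plane. With at
  most one face, Euler's inequality alone gives fewer edges than vertices.\<close>

theorem edge_bound:
  assumes "V \<noteq> {}" and g: "g \<ge> 3"
    and girth: "\<And>b. b \<subseteq> E \<Longrightarrow> b \<noteq> {} \<Longrightarrow> (\<forall>v\<in>V. card {e \<in> b. v \<in> e} \<noteq> 1) \<Longrightarrow> g \<le> card b"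
  shows "(g - 2) * card E < g * card V"
proof -
  have fin: "finite faces" by (rule finite_faces)
  have Euler: "card E + 1 + vertex_components \<le> card faces + card V"
    using Euler_inequality plane_graph_axioms by blast
  have vc: "vertex_components \<ge> 1"
    unfolding vertex_components_def using assms(1) finite_V by (simp add: Suc_le_eq card_gt_0_iff)
  have "card faces \<le> 1 \<or> g * card faces \<le> 2 * card E"
  proof (rule disjCI)
    assume "\<not> g * card faces \<le> 2 * card E"
    show "card faces \<le> 1"
    proof (rule ccontr)
      assume "\<not> card faces \<le> 1"
      then have ge2: "card faces \<ge> 2" by simp
      have bd: "g \<le> card (boundary F)" if "F \<in> faces" for F
      proof -
        have "\<not> faces \<subseteq> {F}" using ge2 card_mono[of "{F}" faces] by auto
        then obtain F2 where "F2 \<in> faces" "F2 \<noteq> F" by blast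
        then have "\<not> connected (- \<Union>(boundary F))" using boundary_separates that by blast
        moreover have "boundary F \<subseteq> E" by (auto simp: boundary_def)
        ultimately obtain b' where b': "b' \<subseteq> boundary F" "b' \<noteq> {}" "\<forall>v\<in>V. card {e \<in> b'. v \<in> e} \<noteq> 1"
          using separating_edges by metis
        then have "g \<le> card b'" using girth \<open>boundary F \<subseteq> E\<close> by blast
        also have "\<dots> \<le> card (boundary F)"
          using b'(1) \<open>boundary F \<subseteq> E\<close> finite_E by (meson card_mono finite_subset)
        finally show ?thesis .
      qed
      have "g * card faces \<le> (\<Sum>F\<in>faces. card (boundary F))"
        using sum_mono[of faces "\<lambda>_. g" "\<lambda>F. card (boundary F)"] bd by (simp add: mult.commute)
      also have "\<dots> = (\<Sum>F\<in>faces. \<Sum>e\<in>E. if F \<in> edge_sides e \<and> card (edge_sides e) = 2 then 1 else 0)"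
        using finite_E by (simp add: boundary_def sum.If_cases Int_def)
      also have "\<dots> = (\<Sum>e\<in>E. \<Sum>F\<in>faces. if F \<in> edge_sides e \<and> card (edge_sides e) = 2 then 1 else 0)"
        by (rule sum.swap)
      also have "\<dots> \<le> (\<Sum>e\<in>E. 2)"
      proof (rule sum_mono)
        fix e assume "e \<in> E"
        have "(\<Sum>F\<in>faces. if F \<in> edge_sides e \<and> card (edge_sides e) = 2 then 1 else 0) =
            card {F \<in> faces. F \<in> edge_sides e \<and> card (edge_sides e) = 2}"
          using fin by (simp add: sum.If_cases Int_def)
        also have "\<dots> \<le> 2"
        proof (cases "card (edge_sides e) = 2")
          case True
          then have "finite (edge_sides e)" by (metis card.infinite zero_neq_numeral)
          then have "card {F \<in> faces. F \<in> edge_sides e \<and> card (edge_sides e) = 2} \<le> card (edge_sides e)"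
            by (intro card_mono) auto
          then show ?thesis using True by simp
        qed simp
        finally show "(\<Sum>F\<in>faces. if F \<in> edge_sides e \<and> card (edge_sides e) = 2 then 1 else 0) \<le> (2::nat)" .
      qed
      finally show False using \<open>\<not> g * card faces \<le> 2 * card E\<close> by simp
    qed
  qed
  then show ?thesis
  proof
    assume "card faces \<le> 1"
    then have "card E < card V" using Euler vc by linarith
    then have "g * card E < g * card V" using g by simp
    moreover have "(g - 2) * card E \<le> g * card E" by simp
    ultimately show ?thesis by linarith
  next
    assume *: "g * card faces \<le> 2 * card E"
    have "card E + 2 \<le> card faces + card V" using Euler vc by linarith
    then have "g * (card E + 2) \<le> g * card faces + g * card V" by (metis distrib_left mult_le_mono2)
    then have "g * card E + 2 * g \<le> 2 * card E + g * card V" using * by (simp add: algebra_simps)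
    moreover have "2 * card E \<le> g * card E" using g by simp
    ultimately show ?thesis unfolding diff_mult_distrib using g by linarith
  qed
qed

end

section \<open>Girth and vertex deletion\<close>

lemma pair_graph_basic:
  assumes "pair_graph G"
  shows "finite (pverts G)" "finite (parcs G)" "parcs G \<subseteq> pverts G \<times> pverts G"
    "(u, v) \<in> parcs G \<Longrightarrow> (v, u) \<in> parcs G" "(u, v) \<in> parcs G \<Longrightarrow> u \<noteq> v"
proof -
  interpret pair_graph G by fact
  show "finite (pverts G)" "finite (parcs G)" by (rule pair_finite_verts pair_finite_arcs)+
  show "parcs G \<subseteq> pverts G \<times> pverts G" using in_arcsD1 in_arcsD2 by auto
  show "(u, v) \<in> parcs G \<Longrightarrow> (v, u) \<in> parcs G" by (rule arcs_symmetric)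
  show "(u, v) \<in> parcs G \<Longrightarrow> u \<noteq> v" using pair_no_loops by force
qed

definition delete_verts :: "'a pair_pre_digraph \<Rightarrow> 'a set \<Rightarrow> 'a pair_pre_digraph" where
  "delete_verts G D = \<lparr>pverts = pverts G - D, parcs = {(u, v) \<in> parcs G. u \<notin> D \<and> v \<notin> D}\<rparr>"

lemma delete_verts_simps [simp]:
  "pverts (delete_verts G D) = pverts G - D"
  "parcs (delete_verts G D) = {(u, v) \<in> parcs G. u \<notin> D \<and> v \<notin> D}"
  by (simp_all add: delete_verts_def)

lemma neighbors_delete_verts: "v \<notin> D \<Longrightarrow> neighbors (delete_verts G D) v = neighbors G v - D"
  by (auto simp: neighbors_def)

lemma pair_graph_delete_verts:
  assumes "pair_graph G" shows "pair_graph (delete_verts G D)"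
proof -
  interpret pair_graph G by fact
  show ?thesis
  proof
    show "finite (parcs (delete_verts G D))"
      using pair_finite_arcs by (rule finite_subset[rotated]) auto
    show "symmetric (with_proj (delete_verts G D))"
      unfolding symmetric_def by (auto intro!: symI arcs_symmetric)
  qed (use pair_finite_verts pair_no_loops in_arcsD1 in_arcsD2 in auto)
qed

lemma planar_delete_verts:
  assumes G: "pair_graph G" and "planar G" shows "planar (delete_verts G D)"
proof -
  obtain pos \<gamma> where "plane_drawing G pos \<gamma>" using assms by (auto simp: planar_def)
  then have d: "inj_on pos (pverts G)"
      "\<And>u v. (u, v) \<in> parcs G \<Longrightarrow> arc (\<gamma> (u, v)) \<and> pathstart (\<gamma> (u, v)) = pos u \<and> pathfinish (\<gamma> (u, v)) = pos v \<and>
        \<gamma> (v, u) = reversepath (\<gamma> (u, v)) \<and> path_image (\<gamma> (u, v)) \<inter> pos ` pverts G = {pos u, pos v}"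
      "\<And>u v x y. (u, v) \<in> parcs G \<Longrightarrow> (x, y) \<in> parcs G \<Longrightarrow> {u, v} \<noteq> {x, y} \<Longrightarrow>
        path_image (\<gamma> (u, v)) \<inter> path_image (\<gamma> (x, y)) \<subseteq> pos ` ({u, v} \<inter> {x, y})"
    unfolding plane_drawing_def by blast+
  have "path_image (\<gamma> (u, v)) \<inter> pos ` (pverts G - D) = {pos u, pos v}"
    if "(u, v) \<in> parcs G" "u \<notin> D" "v \<notin> D" for u v
  proof -
    have "u \<in> pverts G - D" "v \<in> pverts G - D" using pair_graph_basic(3)[OF G] that by auto
    then show ?thesis using d(2)[OF that(1)] by blast
  qed
  then have "plane_drawing (delete_verts G D) pos \<gamma>"
    unfolding plane_drawing_def using inj_on_diff[OF d(1)] d(2,3) by auto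
  then show ?thesis by (auto simp: planar_def)
qed

lemma girth_delete_verts:
  assumes "pair_graph G" shows "girth G \<le> girth (delete_verts G D)"
proof -
  have "pre_digraph.cycle (with_proj G) p" if "pre_digraph.cycle (with_proj (delete_verts G D)) p" for p
    using that
    by (auto simp: pre_digraph.cycle_def pre_digraph.awalk_def cas_with_proj_eq awalk_verts_with_proj_eq)
  then show ?thesis unfolding girth_def by (intro INF_superset_mono) auto
qed

lemma cycle_if_girth_le:
  assumes "pair_graph G" "girth G \<ge> enat g" "pcas u p u" "set p \<subseteq> parcs G" "length p \<ge> 3"
    "u \<in> pverts G" "distinct (tl (pawalk_verts u p))"
  shows "g \<le> length p"
proof -
  have "pre_digraph.cycle (with_proj G) p"
    using assms by (auto simp: pre_digraph.cycle_def pre_digraph.awalk_def cas_with_proj_eq awalk_verts_with_proj_eq)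
  then have "girth G \<le> enat (length p)"
    unfolding girth_def using assms(5) by (intro INF_lower) auto
  then show ?thesis using assms(2) by (metis enat_ord_simps(1) order_trans)
qed

text \<open>In this form the girth enters the recolouring: neighbours of a vertex are pairwise
  non-adjacent, and two vertices have at most one common neighbour.\<close>

lemma common_neighbors_girth5:
  assumes G: "pair_graph G" "girth G \<ge> 5"
  shows no_triangle: "\<lbrakk>(u, v) \<in> parcs G; (v, w) \<in> parcs G\<rbrakk> \<Longrightarrow> (w, u) \<notin> parcs G"
    and no_square: "\<lbrakk>(u, v) \<in> parcs G; (v, w) \<in> parcs G; (w, x) \<in> parcs G; (x, u) \<in> parcs G; u \<noteq> w\<rbrakk> \<Longrightarrow> v = x"
proof -
  note b = pair_graph_basic[OF G(1)]
  have g: "girth G \<ge> enat 5" using G by (simp add: numeral_eq_enat)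
  show "(w, u) \<notin> parcs G" if uv: "(u, v) \<in> parcs G" "(v, w) \<in> parcs G"
  proof
    assume wu: "(w, u) \<in> parcs G"
    have "5 \<le> length [(u, v), (v, w), (w, u)]"
      by (rule cycle_if_girth_le[OF G(1) g, of u]) (use uv wu b in auto)
    then show False by simp
  qed
  show "v = x" if uv: "(u, v) \<in> parcs G" "(v, w) \<in> parcs G" "(w, x) \<in> parcs G" "(x, u) \<in> parcs G" "u \<noteq> w"
  proof (rule ccontr)
    assume "v \<noteq> x"
    have "5 \<le> length [(u, v), (v, w), (w, x), (x, u)]"
      by (rule cycle_if_girth_le[OF G(1) g, of u]) (use uv \<open>v \<noteq> x\<close> b in auto)
    then show False by simp
  qed
qed

section \<open>Edge bound for planar graphs of given girth\<close>

lemma pawalk_arcs: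
  assumes "pcas u p v" "distinct (pawalk_verts u p)"
  shows "distinct p" "a \<in> set p \<Longrightarrow> fst a \<in> set (pawalk_verts u p) \<and> snd a \<in> set (pawalk_verts u p)"
    "(x, y) \<in> set p \<Longrightarrow> (y, x) \<notin> set p"
proof -
  have hd_in: "pcas s q v \<Longrightarrow> s \<in> set (pawalk_verts s q)" for s q by (cases q) auto
  have "pcas u p v \<Longrightarrow> distinct (pawalk_verts u p) \<Longrightarrow>
     distinct p \<and> (\<forall>a\<in>set p. fst a \<in> set (pawalk_verts u p) \<and> snd a \<in> set (pawalk_verts u p)) \<and>
     (\<forall>x y. (x, y) \<in> set p \<longrightarrow> (y, x) \<notin> set p)"
  proof (induction p arbitrary: u)
    case (Cons e p)
    obtain s where e: "e = (u, s)" using Cons.prems by (cases e) auto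
    have "pcas s p v" "distinct (pawalk_verts s p)" "u \<notin> set (pawalk_verts s p)"
      using Cons.prems e by auto
    with Cons.IH[of s] show ?case using e hd_in[of s p] by fastforce
  qed simp
  with assms show "distinct p" "a \<in> set p \<Longrightarrow> fst a \<in> set (pawalk_verts u p) \<and> snd a \<in> set (pawalk_verts u p)"
    "(x, y) \<in> set p \<Longrightarrow> (y, x) \<notin> set p" by blast+
qed

text \<open>Keeping the first arc shows in \<open>ex_cycle\<close> that a nonempty prefix not ending
  at the second vertex of the path has at least two arcs.\<close>

lemma pawalk_prefix:
  assumes "pcas u p v" "distinct (pawalk_verts u p)" "w \<in> set (pawalk_verts u p)"
  shows "\<exists>q. pcas u q w \<and> distinct (pawalk_verts u q) \<and> set q \<subseteq> set p \<and>
    set (pawalk_verts u q) \<subseteq> set (pawalk_verts u p) \<and> (q = [] \<or> hd q = hd p)"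
  using assms
proof (induction p arbitrary: u)
  case Nil then show ?case by (intro exI[of _ "[]"]) auto
next
  case (Cons e p)
  obtain s where e: "e = (u, s)" using Cons.prems by (cases e) auto
  show ?case
  proof (cases "w = u")
    case True then show ?thesis using e by (intro exI[of _ "[]"]) auto
  next
    case False
    then obtain q where q: "pcas s q w" "distinct (pawalk_verts s q)" "set q \<subseteq> set p"
        "set (pawalk_verts s q) \<subseteq> set (pawalk_verts s p)"
      using Cons.IH[of s] Cons.prems e by auto
    then show ?thesis using Cons.prems e by (intro exI[of _ "e # q"]) auto
  qed
qed

text \<open>Extend a longest path \<open>p\<close> at its first vertex.\<close>

lemma ex_cycle:
  assumes fin: "finite A" and sym: "\<And>x y. (x, y) \<in> A \<Longrightarrow> (y, x) \<in> A" and irr: "\<And>x. (x, x) \<notin> A"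
    and "A \<noteq> {}" and deg: "\<And>x y. (x, y) \<in> A \<Longrightarrow> \<exists>z. z \<noteq> y \<and> (x, z) \<in> A"
  obtains u p where "pcas u p u" "distinct (tl (pawalk_verts u p))" "set p \<subseteq> A" "length p \<ge> 3"
    "distinct p" "\<And>x y. (x, y) \<in> set p \<Longrightarrow> (y, x) \<notin> set p"
proof -
  define Q where "Q = (\<lambda>p. \<exists>u v. pcas u p v \<and> distinct (pawalk_verts u p) \<and> set p \<subseteq> A)"
  have bound: "length p \<le> card A" if "Q p" for p
  proof -
    note Qp = that
    obtain u v where "pcas u p v" "distinct (pawalk_verts u p)" "set p \<subseteq> A"
      using Qp by (auto simp: Q_def)
    then show ?thesis using pawalk_arcs(1)[of u p v] fin by (metis card_mono distinct_card)
  qed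
  obtain x y where "(x, y) \<in> A" using \<open>A \<noteq> {}\<close> by auto
  then have "Q [(x, y)]" using irr unfolding Q_def by (intro exI[of _ x] exI[of _ y]) auto
  then obtain p where p: "Q p" and max: "\<And>q. Q q \<Longrightarrow> length q \<le> length p"
    using ex_has_greatest_nat[of Q "[(x, y)]" length "Suc (card A)"] bound le_imp_less_Suc by blast
  have "length p \<ge> 1" using max[OF \<open>Q [(x, y)]\<close>] by simp
  obtain u v where uv: "pcas u p v" "distinct (pawalk_verts u p)" "set p \<subseteq> A"
    using p by (auto simp: Q_def)
  obtain x p' where px: "p = (u, x) # p'" using uv(1) \<open>length p \<ge> 1\<close> by (cases p) auto
  \<comment> \<open>By maximality this further neighbour of the first vertex lies on the path. The
    prefix up to \<open>w\<close>, closed by \<open>(w, u)\<close>, is the cycle;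
    \<open>w \<noteq> x\<close> makes its length at least three.\<close>
  obtain w where w: "w \<noteq> x" "(u, w) \<in> A" using deg[of u x] uv(3) px by auto
  have "w \<in> set (pawalk_verts u p)"
  proof (rule ccontr)
    assume "w \<notin> set (pawalk_verts u p)"
    then have "Q ((w, u) # p)" using uv sym[OF w(2)] unfolding Q_def by (intro exI[of _ w] exI[of _ v]) auto
    then show False using max by fastforce
  qed
  then obtain q where q: "pcas u q w" "distinct (pawalk_verts u q)" "set q \<subseteq> set p" "q = [] \<or> hd q = (u, x)"
    using pawalk_prefix[OF uv(1,2), of w] px by (metis list.sel(1))
  have "w \<noteq> u" using w irr by auto
  then obtain q' where qq: "q = (u, x) # q'" using q(1,4) by (cases q) auto
  then have "q' \<noteq> []" using q(1) w(1) by auto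
  have u': "u \<notin> set (pawalk_verts x q')" using q(2) qq by auto
  have q': "pcas x q' w" "distinct (pawalk_verts x q')" using q qq by auto
  have nq: "fst a \<noteq> u" "snd a \<noteq> u" if "a \<in> set q'" for a
    using pawalk_arcs(2)[OF q' that] u' by auto
  show thesis
  proof
    show "pcas w ((w, u) # q) w" using q by simp
    show "distinct (tl (pawalk_verts w ((w, u) # q)))" using q by simp
    show "set ((w, u) # q) \<subseteq> A" using q uv(3) sym[OF w(2)] by auto
    show "length ((w, u) # q) \<ge> 3" using qq \<open>q' \<noteq> []\<close> by (cases q') auto
    have "(w, u) \<notin> set q" using qq \<open>w \<noteq> u\<close> nq(2)[of "(w, u)"] by auto
    then show "distinct ((w, u) # q)" using pawalk_arcs(1)[OF q(1,2)] by simp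
    have "(u, w) \<notin> set q" using qq w(1) nq(1)[of "(u, w)"] by auto
    then show "(b, a) \<notin> set ((w, u) # q)" if "(a, b) \<in> set ((w, u) # q)" for a b
      using that pawalk_arcs(3)[OF q(1,2), of a b] \<open>(w, u) \<notin> set q\<close> \<open>w \<noteq> u\<close> by auto
  qed
qed

text \<open>The ends of a drawn edge can be read off its image by intersecting with the vertex
  points, so different edges have different images, while the two arcs of one edge share
  theirs.\<close>

lemma plane_graph_of_drawing:
  assumes G: "pair_graph G" and draw: "plane_drawing G pos \<gamma>"
    and im_def: "im = (\<lambda>a. path_image (\<gamma> a))"
  shows "plane_graph (pos ` pverts G) (im ` parcs G)"
    and "(u, v) \<in> parcs G \<Longrightarrow> (x, y) \<in> parcs G \<Longrightarrow>
      im (u, v) = im (x, y) \<longleftrightarrow> (x, y) = (u, v) \<or> (x, y) = (v, u)"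
    and "(u, v) \<in> parcs G \<Longrightarrow> im (u, v) \<inter> pos ` pverts G = {pos u, pos v}"
proof -
  note basic = pair_graph_basic[OF G]
  have inj: "inj_on pos (pverts G)" using draw by (simp add: plane_drawing_def)
  have d: "arc (\<gamma> (u, v)) \<and> pathstart (\<gamma> (u, v)) = pos u \<and> pathfinish (\<gamma> (u, v)) = pos v \<and>
        \<gamma> (v, u) = reversepath (\<gamma> (u, v)) \<and> path_image (\<gamma> (u, v)) \<inter> pos ` pverts G = {pos u, pos v}"
    if "(u, v) \<in> parcs G" for u v
    using draw that unfolding plane_drawing_def by blast
  have cross: "im (u, v) \<inter> im (x, y) \<subseteq> pos ` ({u, v} \<inter> {x, y})"
    if "(u, v) \<in> parcs G" "(x, y) \<in> parcs G" "{u, v} \<noteq> {x, y}" for u v x y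
    using draw that unfolding plane_drawing_def im_def by blast
  show ends: "im (u, v) \<inter> pos ` pverts G = {pos u, pos v}" if "(u, v) \<in> parcs G" for u v
    using d[OF that] by (simp add: im_def)
  have rev: "im (v, u) = im (u, v)" if "(u, v) \<in> parcs G" for u v
    using d[OF that] by (simp add: im_def)
  show im_eq: "im (u, v) = im (x, y) \<longleftrightarrow> (x, y) = (u, v) \<or> (x, y) = (v, u)"
    if "(u, v) \<in> parcs G" "(x, y) \<in> parcs G" for u v x y
  proof
    assume "im (u, v) = im (x, y)"
    then have "{pos u, pos v} = {pos x, pos y}" using ends[OF that(1)] ends[OF that(2)] by simp
    then have "pos ` {u, v} = pos ` {x, y}" by simp
    then have "{u, v} = {x, y}"
      using inj_on_image_eq_iff[OF inj, of "{u, v}" "{x, y}"] that basic(3) by blast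
    then show "(x, y) = (u, v) \<or> (x, y) = (v, u)" by (auto simp: doubleton_eq_iff)
  qed (use rev that in auto)
  show "plane_graph (pos ` pverts G) (im ` parcs G)"
  proof
    show "finite (pos ` pverts G)" "finite (im ` parcs G)" using basic(1,2) by auto
  next
    fix e assume "e \<in> im ` parcs G"
    then obtain u v where uv: "(u, v) \<in> parcs G" "e = im (u, v)" by auto
    then show "\<exists>g. arc g \<and> path_image g = e \<and> e \<inter> pos ` pverts G = {pathstart g, pathfinish g}"
      using d[OF uv(1)] unfolding im_def by (intro exI[of _ "\<gamma> (u, v)"]) auto
  next
    fix e e' assume "e \<in> im ` parcs G" "e' \<in> im ` parcs G" and ne: "e \<noteq> e'"
    then obtain u v x y where uv: "(u, v) \<in> parcs G" "e = im (u, v)"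
      and xy: "(x, y) \<in> parcs G" "e' = im (x, y)" by auto
    have "{u, v} \<noteq> {x, y}" using ne im_eq[OF uv(1) xy(1)] uv xy by (auto simp: doubleton_eq_iff)
    then have "e \<inter> e' \<subseteq> pos ` ({u, v} \<inter> {x, y})" using cross uv xy by simp
    moreover have "{u, v} \<subseteq> pverts G" using uv basic(3) by auto
    ultimately show "e \<inter> e' \<subseteq> pos ` pverts G" by blast
  qed
qed

text \<open>An edge set without vertices of degree one pulls back to a symmetric arc set in which
  every vertex has a second neighbour. Its cycle uses each drawn edge at most once, so the girth
  bounds the size of the set. The extra factor two arises because \<open>parcs\<close> lists both
  orientations.\<close>

theorem planar_girth_edge_bound:
  assumes G: "pair_graph G" "planar G" and girth: "girth G \<ge> enat g" and g: "g \<ge> 3"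
    and ne: "pverts G \<noteq> {}"
  shows "(g - 2) * card (parcs G) < 2 * g * card (pverts G)"
proof -
  note basic = pair_graph_basic[OF G(1)]
  obtain pos \<gamma> where draw: "plane_drawing G pos \<gamma>" using G(2) by (auto simp: planar_def)
  define im where "im = (\<lambda>a. path_image (\<gamma> a))"
  note plane = plane_graph_of_drawing[OF G(1) draw im_def]
  let ?V = "pos ` pverts G" and ?E = "im ` parcs G"
  interpret plane_graph ?V ?E by (rule plane(1))
  have inj: "inj_on pos (pverts G)" using draw by (simp add: plane_drawing_def)
  have deg: "g \<le> card b" if b: "b \<subseteq> ?E" "b \<noteq> {}" "\<forall>v\<in>?V. card {e \<in> b. v \<in> e} \<noteq> 1" for b
  proof -
    define A where "A = {a \<in> parcs G. im a \<in> b}"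
    have finb: "finite b" using b(1) basic(2) finite_subset by blast
    have "finite A" using basic(2) by (simp add: A_def)
    moreover have "(y, x) \<in> A" if "(x, y) \<in> A" for x y
    proof -
      have xy: "(x, y) \<in> parcs G" "(y, x) \<in> parcs G" using that basic(4) by (auto simp: A_def)
      then have "im (x, y) = im (y, x)" using plane(2) by blast
      then show ?thesis using that xy by (simp add: A_def)
    qed
    moreover have "(x, x) \<notin> A" for x using basic(5) by (auto simp: A_def)
    moreover have "A \<noteq> {}" using b(1,2) by (auto simp: A_def)
    moreover have "\<exists>z. z \<noteq> y \<and> (x, z) \<in> A" if xy: "(x, y) \<in> A" for x y
    proof -
      have a: "(x, y) \<in> parcs G" "im (x, y) \<in> b" using xy by (auto simp: A_def)
      then have "x \<in> pverts G" using basic(3) by auto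
      let ?S = "{e \<in> b. pos x \<in> e}"
      have "im (x, y) \<in> ?S" using plane(3)[OF a(1)] a(2) by auto
      moreover have "?S \<noteq> {im (x, y)}"
      proof
        assume "?S = {im (x, y)}"
        then have "card ?S = 1" by simp
        then show False using b(3) \<open>x \<in> pverts G\<close> by blast
      qed
      ultimately obtain e where e: "e \<in> b" "pos x \<in> e" "e \<noteq> im (x, y)" by blast
      have "e \<in> ?E" using e(1) b(1) by blast
      then obtain s t where st: "(s, t) \<in> parcs G" "e = im (s, t)" by auto
      have "pos x \<in> {pos s, pos t}" using plane(3)[OF st(1)] e(2) st(2) \<open>x \<in> pverts G\<close> by blast
      moreover have "s \<in> pverts G" "t \<in> pverts G" using st(1) basic(3) by auto
      ultimately have "x = s \<or> x = t" using inj \<open>x \<in> pverts G\<close> by (auto dest: inj_onD)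
      moreover have "im (t, s) = im (s, t)" "(t, s) \<in> parcs G" using plane(2) st(1) basic(4) by blast+
      ultimately obtain z where "(x, z) \<in> parcs G" "e = im (x, z)" using st by metis
      then show ?thesis using e by (auto simp: A_def)
    qed
    ultimately obtain u p where p: "pcas u p u" "distinct (tl (pawalk_verts u p))" "set p \<subseteq> A" "length p \<ge> 3"
      "distinct p" "\<And>x y. (x, y) \<in> set p \<Longrightarrow> (y, x) \<notin> set p"
      by (rule ex_cycle[of A]) blast+
    have pG: "set p \<subseteq> parcs G" using p(3) by (auto simp: A_def)
    have "u \<in> pverts G"
    proof (cases p)
      case (Cons a q) then show ?thesis using p(1) pG basic(3) by auto
    qed (use p(4) in simp)
    then have "g \<le> length p" using cycle_if_girth_le[OF G(1) girth p(1) pG p(4)] p(2) by blast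
    also have "length p = card (set p)" using p(5) by (simp add: distinct_card)
    also have "\<dots> = card (im ` set p)"
    proof (rule card_image[symmetric], rule inj_onI)
      fix a a' assume a: "a \<in> set p" "a' \<in> set p" "im a = im a'"
      obtain x y x' y' where xy: "a = (x, y)" "a' = (x', y')" by fastforce
      then have "(x', y') = (x, y) \<or> (x', y') = (y, x)" using plane(2) a pG by blast
      then show "a = a'" using a p(6) xy by auto
    qed
    also have "\<dots> \<le> card b" using p(3) finb by (intro card_mono) (auto simp: A_def)
    finally show ?thesis .
  qed
  have bound: "(g - 2) * card ?E < g * card ?V"
    by (rule edge_bound[OF _ g]) (use ne deg in auto)
  have "card (parcs G) \<le> 2 * card ?E"
  proof -
    have "card (parcs G) = (\<Sum>e\<in>?E. card {a \<in> parcs G. im a = e})"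
      using sum.image_gen[OF basic(2), of "\<lambda>_. 1::nat" im] by simp
    also have "\<dots> \<le> (\<Sum>e\<in>?E. 2)"
    proof (rule sum_mono)
      fix e assume "e \<in> ?E"
      then obtain u v where uv: "(u, v) \<in> parcs G" "e = im (u, v)" by auto
      have "{a \<in> parcs G. im a = e} \<subseteq> {(u, v), (v, u)}"
      proof
        fix a assume "a \<in> {a \<in> parcs G. im a = e}"
        then obtain x y where "a = (x, y)" "(x, y) \<in> parcs G" "im (u, v) = im (x, y)" using uv by (cases a) auto
        then show "a \<in> {(u, v), (v, u)}" using plane(2)[OF uv(1)] by blast
      qed
      then have "card {a \<in> parcs G. im a = e} \<le> card {(u, v), (v, u)}" by (intro card_mono) auto
      also have "\<dots> \<le> 2" by (cases "u = v") simp_all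
      finally show "card {a \<in> parcs G. im a = e} \<le> 2" .
    qed
    finally show ?thesis by simp
  qed
  then have "(g - 2) * card (parcs G) \<le> (g - 2) * (2 * card ?E)" by (rule mult_le_mono2)
  also have "\<dots> < 2 * g * card ?V" using bound by simp
  also have "card ?V = card (pverts G)" using inj by (rule card_image)
  finally show ?thesis .
qed

section \<open>Reducible vertices\<close>

definition odd_colors :: "('a \<Rightarrow> nat) \<Rightarrow> 'a set \<Rightarrow> nat set" where
  "odd_colors f A = {i. odd (card {u \<in> A. f u = i})}"

lemma odd_colors_subset: "odd_colors f A \<subseteq> f ` A"
proof
  fix i assume "i \<in> odd_colors f A"
  then have "{u \<in> A. f u = i} \<noteq> {}" unfolding odd_colors_def by fastforce
  then show "i \<in> f ` A" by auto
qed

text \<open>A sum of even class sizes is even. Hence vertices of odd degree are satisfied by every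
  colouring.\<close>

lemma odd_colors_odd_card:
  assumes "finite A" "odd (card A)" shows "odd_colors f A \<noteq> {}"
proof
  assume e: "odd_colors f A = {}"
  have "card A = (\<Sum>i\<in>f ` A. card {u \<in> A. f u = i})"
    using sum.image_gen[OF assms(1), of "\<lambda>_. 1::nat" f] by simp
  moreover have "even (\<Sum>i\<in>f ` A. card {u \<in> A. f u = i})"
    using e by (intro dvd_sum) (auto simp: odd_colors_def)
  ultimately show False using assms(2) by simp
qed

text \<open>Adding \<open>v\<close> toggles the parity of the colour \<open>f v\<close> alone, so
  the odd colours vanish only if they were exactly \<open>{f v}\<close>. A neighbourhood completed
  by one last vertex thus forbids it at most one colour.\<close>

lemma odd_colors_insert:
  assumes "finite A" "v \<notin> A" "odd_colors f A \<noteq> {f v}"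
  shows "odd_colors f (insert v A) \<noteq> {}"
proof -
  have eq: "{u \<in> insert v A. f u = i} = (if f v = i then insert v {u \<in> A. f u = i} else {u \<in> A. f u = i})" for i
    by auto
  have mem: "i \<in> odd_colors f (insert v A) \<longleftrightarrow> (if f v = i then i \<notin> odd_colors f A else i \<in> odd_colors f A)" for i
    unfolding odd_colors_def mem_Collect_eq eq using assms(1,2) by simp
  show ?thesis
  proof (cases "f v \<in> odd_colors f A")
    case True
    then obtain i where "i \<in> odd_colors f A" "i \<noteq> f v" using assms(3) by blast
    then show ?thesis using mem[of i] by auto
  next
    case False then show ?thesis using mem[of "f v"] by auto
  qed
qed

lemma odd_colors_cong:
  assumes "\<And>u. u \<in> A \<Longrightarrow> f u = h u" shows "odd_colors f A = odd_colors h A"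
proof -
  have "{u \<in> A. f u = i} = {u \<in> A. h u = i}" for i using assms by auto
  then show ?thesis by (simp add: odd_colors_def)
qed

lemma odd_coloring_iff:
  "odd_coloring G c f \<longleftrightarrow> proper_coloring G c f \<and>
    (\<forall>v\<in>pverts G. degree G v > 0 \<longrightarrow> odd_colors f (neighbors G v) \<noteq> {})" if "pair_graph G"
proof -
  have "(\<exists>i<c. odd (card {u \<in> neighbors G v. f u = i})) \<longleftrightarrow> odd_colors f (neighbors G v) \<noteq> {}"
    if "proper_coloring G c f" for v
  proof -
    have "f ` neighbors G v \<subseteq> {..<c}"
      using that pair_graph_basic(3)[OF \<open>pair_graph G\<close>] by (auto simp: proper_coloring_def neighbors_def)
    then have "odd_colors f (neighbors G v) \<subseteq> {..<c}"
      using odd_colors_subset[of f "neighbors G v"] by (rule subset_trans[rotated])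
    then show ?thesis unfolding odd_colors_def by blast
  qed
  then show ?thesis unfolding odd_coloring_def by blast
qed

lemma ex_color: "finite A \<Longrightarrow> card A < c \<Longrightarrow> \<exists>a<c. a \<notin> (A :: nat set)"
  by (metis card_lessThan card_mono lessThan_iff not_le subsetI)

lemma finite_neighbors: "pair_graph G \<Longrightarrow> finite (neighbors G v)"
  using pair_graph_basic(1,3)[of G] by (auto simp: neighbors_def intro: finite_subset)

definition two_neighbors :: "'a pair_pre_digraph \<Rightarrow> 'a \<Rightarrow> 'a set" where
  "two_neighbors G v = {w \<in> neighbors G v. degree G w = 2}"

text \<open>The number of colours that an odd colouring of \<open>G\<close> without \<open>v\<close> and its neighbours of degree
  two can forbid at \<open>v\<close>: such a neighbour must not see the same colour twice, any other
  neighbour forbids its own colour, and possibly its only odd colour if its degree is even.\<close>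
definition forbidden_bound :: "'a pair_pre_digraph \<Rightarrow> 'a \<Rightarrow> nat" where
  "forbidden_bound G v =
    2 * card {y \<in> neighbors G v. degree G y \<noteq> 2 \<and> even (degree G y)} +
    card {y \<in> neighbors G v. odd (degree G y)} + card (two_neighbors G v)"

text \<open>First \<open>v\<close> is coloured, then \<open>W\<close>. Without triangles and squares
  every vertex outside \<open>D\<close> has at most one neighbour in \<open>D\<close>, so
  \<open>odd_colors_insert\<close> applies to it. Each vertex of \<open>W\<close> has three
  forbidden colours, and one of them gets a fourth to settle \<open>v\<close> itself;
  \<open>c \<ge> 5\<close> leaves a choice. If \<open>W\<close> is empty, \<open>v\<close> is
  isolated or of odd degree.\<close>

lemma reducible_vertex:
  fixes G :: "'a pair_pre_digraph"
  assumes G: "pair_graph G" "girth G \<ge> 5" and c: "c \<ge> 5" and v: "v \<in> pverts G"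
    and odd_at_v: "degree G v = 0 \<or> odd (degree G v) \<or> two_neighbors G v \<noteq> {}"
    and few: "forbidden_bound G v < c"
    and f: "odd_coloring (delete_verts G (insert v (two_neighbors G v))) c f"
  shows "odd_colorable G c"
proof -
  note basic = pair_graph_basic[OF G(1)]
  let ?N = "neighbors G"
  define W where "W = two_neighbors G v"
  define Y where "Y = ?N v - W"
  define Ye where "Ye = {y \<in> ?N v. degree G y \<noteq> 2 \<and> even (degree G y)}"
  define Yo where "Yo = {y \<in> ?N v. odd (degree G y)}"
  define D where "D = insert v W"
  define H where "H = delete_verts G D"
  have fin: "finite (?N u)" for u by (rule finite_neighbors[OF G(1)])
  have Nsym: "u \<in> ?N w \<longleftrightarrow> w \<in> ?N u" for u w using basic(4) by (auto simp: neighbors_def)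
  have Nirr: "u \<notin> ?N u" for u using basic(5) by (auto simp: neighbors_def)
  have tri: "w \<notin> ?N u" if "x \<in> ?N u" "w \<in> ?N x" for u x w
    using no_triangle[OF G, of u x w] that Nsym[of u w] by (auto simp: neighbors_def)
  have sq: "x = y" if "x \<in> ?N u" "x \<in> ?N w" "y \<in> ?N u" "y \<in> ?N w" "u \<noteq> w" for u w x y
    using no_square[OF G, of u x w y] that basic(4) by (auto simp: neighbors_def)
  have W: "W \<subseteq> ?N v" "finite W" using fin[of v] by (auto simp: W_def two_neighbors_def)
  have Yeo: "Y = Ye \<union> Yo" by (auto simp: Y_def W_def Ye_def Yo_def two_neighbors_def)
  have finY: "finite Ye" "finite Yo" using fin[of v] by (auto simp: Ye_def Yo_def)
  have vW: "v \<notin> W" using W Nirr by blast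
  have "\<exists>z. ?N w = {v, z} \<and> z \<noteq> v" if "w \<in> W" for w
  proof -
    have "card (?N w) = 2" using that by (auto simp: W_def two_neighbors_def degree_def)
    moreover have "v \<in> ?N w" using that W Nsym by blast
    ultimately show ?thesis by (metis card_2_iff doubleton_eq_iff insertE singletonD)
  qed
  then obtain z where z: "\<And>w. w \<in> W \<Longrightarrow> ?N w = {v, z w} \<and> z w \<noteq> v" by metis
  have zD: "z w \<notin> D" if "w \<in> W" for w
  proof -
    have "z w \<notin> ?N v" using tri[of w v "z w"] that W z by blast
    then show ?thesis using z[OF that] W by (auto simp: D_def)
  qed
  \<comment> \<open>If the set of odd colours is not a singleton, \<open>the_elem\<close> yields an
    unspecified colour, and forbidding it does no harm. The colours \<open>f (z w)\<close> are
    forbidden so that \<open>w\<close> sees two different colours.\<close>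
  define F where "F = f ` Y \<union> (\<lambda>y. the_elem (odd_colors f (?N y - {v}))) ` Ye \<union> (f \<circ> z) ` W"
  have "card F \<le> card (f ` Y) + card ((\<lambda>y. the_elem (odd_colors f (?N y - {v}))) ` Ye) + card ((f \<circ> z) ` W)"
    unfolding F_def by (meson card_Un_le order_trans add_right_mono)
  also have "\<dots> \<le> (card Ye + card Yo) + card Ye + card W"
    using finY W(2) card_image_le[of Y f] card_Un_le[of Ye Yo] unfolding Yeo
    by (intro add_mono card_image_le) (auto intro: order_trans)
  also have "\<dots> < c" using few by (simp add: forbidden_bound_def Ye_def Yo_def W_def)
  finally have "card F < c" .
  moreover have "finite F" using finY W(2) Yeo by (auto simp: F_def)
  ultimately obtain a where a: "a < c" "a \<notin> F" using ex_color by metis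
  \<comment> \<open>The colours of the two neighbours of \<open>w\<close>, and the one that could
    leave \<open>z w\<close> without an odd colour.\<close>
  define Fw where "Fw = (\<lambda>w. {a, f (z w), the_elem (odd_colors f (?N (z w) - {w}))})"
  have cardFw: "card (Fw w) \<le> 3" "finite (Fw w)" for w
    by (simp_all add: Fw_def card_insert_if)
  have "\<exists>b<c. b \<notin> Fw w" for w using ex_color[of "Fw w" c] cardFw[of w] c by simp
  then obtain h0 where h0: "\<And>w. h0 w < c \<and> h0 w \<notin> Fw w" by metis
  define col where "col = (\<lambda>h u. if u = v then a else if u \<in> W then h u else f u)"
  have "\<exists>h. (\<forall>w. h w < c \<and> h w \<notin> Fw w) \<and> (W \<noteq> {} \<longrightarrow> odd_colors (col h) (?N v) \<noteq> {})"
  proof (cases "W = {}")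
    case True then show ?thesis using h0 by blast
  next
    case False
    then obtain w where w: "w \<in> W" by auto
    \<comment> \<open>The only colour of \<open>w\<close> that could cancel every odd colour around
      \<open>v\<close>.\<close>
    let ?o = "the_elem (odd_colors (col h0) (?N v - {w}))"
    have "card (insert ?o (Fw w)) < c" using cardFw[of w] c by (simp add: card_insert_if)
    then obtain b where b: "b < c" "b \<notin> insert ?o (Fw w)"
      using ex_color[of "insert ?o (Fw w)" c] cardFw by auto
    define h where "h = h0(w := b)"
    have "odd_colors (col h) (?N v - {w}) = odd_colors (col h0) (?N v - {w})"
      by (intro odd_colors_cong) (auto simp: col_def h_def)
    moreover have "col h w = b" using w vW by (auto simp: col_def h_def)
    ultimately have "odd_colors (col h) (?N v - {w}) \<noteq> {col h w}" using b by auto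
    then have "odd_colors (col h) (insert w (?N v - {w})) \<noteq> {}"
      using fin[of v] by (intro odd_colors_insert) auto
    moreover have "insert w (?N v - {w}) = ?N v" using w W by auto
    moreover have "\<forall>w. h w < c \<and> h w \<notin> Fw w" using h0 b by (auto simp: h_def)
    ultimately show ?thesis by auto
  qed
  then obtain h where h: "\<And>w. h w < c" "\<And>w. h w \<notin> Fw w"
    and hv: "W \<noteq> {} \<Longrightarrow> odd_colors (col h) (?N v) \<noteq> {}" by blast
  let ?f = "col h"
  have fv: "?f v = a" by (simp add: col_def)
  have fW: "?f w = h w" if "w \<in> W" for w using that vW by (auto simp: col_def)
  have fo: "?f u = f u" if "u \<notin> D" for u using that by (auto simp: col_def D_def)
  have fH: "odd_coloring H c f" using f by (simp add: H_def D_def W_def)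
  have Hg: "pair_graph H" unfolding H_def by (rule pair_graph_delete_verts[OF G(1)])
  have propH: "proper_coloring H c f" using fH by (simp add: odd_coloring_def)
  have oddH: "odd_colors f (?N u - D) \<noteq> {}" if "u \<in> pverts G - D" "?N u - D \<noteq> {}" for u
  proof -
    have "neighbors H u = ?N u - D" using that by (simp add: H_def neighbors_delete_verts)
    moreover have "degree H u > 0" using that calculation fin[of u] by (simp add: degree_def card_gt_0_iff)
    moreover have "u \<in> pverts H" using that by (simp add: H_def)
    ultimately show ?thesis using fH unfolding odd_coloring_iff[OF Hg] by metis
  qed
  have colD: "?f u \<noteq> ?f w" if "u \<in> D" "w \<in> ?N u" for u w
  proof (cases "u = v")
    case True
    show ?thesis
    proof (cases "w \<in> W")
      case True
      then show ?thesis using h(2)[of w] fW[of w] \<open>u = v\<close> fv by (auto simp: Fw_def)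
    next
      case False
      then have "w \<in> Y" using that True by (simp add: Y_def)
      then have "f w \<in> F" "w \<notin> D" using False that True Nirr by (auto simp: F_def D_def)
      then show ?thesis using a fo fv True by auto
    qed
  next
    case False
    then have u: "u \<in> W" using that by (simp add: D_def)
    then have "w = v \<or> w = z u" using z that by blast
    then show ?thesis using h(2)[of u] fW[OF u] fv fo[OF zD[OF u]] by (auto simp: Fw_def)
  qed
  have proper: "proper_coloring G c ?f"
  proof -
    have "?f u < c" if "u \<in> pverts G" for u
    proof (cases "u \<in> D")
      case True then show ?thesis using fv fW h(1) a by (auto simp: D_def)
    next
      case False
      then have "f u \<in> {..<c}" using propH that unfolding proper_coloring_def H_def by auto
      then show ?thesis using fo[OF False] by simp
    qed
    moreover have "?f u \<noteq> ?f w" if e: "(u, w) \<in> parcs G" for u w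
    proof -
      have n: "w \<in> ?N u" "u \<in> ?N w" using e Nsym by (auto simp: neighbors_def)
      consider "u \<in> D" | "w \<in> D" | "u \<notin> D" "w \<notin> D" by blast
      then show ?thesis
      proof cases
        case 1 then show ?thesis using colD n by blast
      next
        case 2 then show ?thesis using colD[of w u] n by metis
      next
        case 3
        then have "f u \<noteq> f w" using propH e unfolding proper_coloring_def H_def by auto
        then show ?thesis using fo 3 by simp
      qed
    qed
    ultimately show ?thesis unfolding proper_coloring_def by auto
  qed
  have "odd_colors ?f (?N u) \<noteq> {}" if u: "u \<in> pverts G" "degree G u > 0" for u
  proof -
    consider "u = v" | "u \<in> W" | "u \<in> Y" | w where "w \<in> W" "u = z w"
      | "u \<notin> D" "v \<notin> ?N u" "\<And>w. w \<in> W \<Longrightarrow> w \<notin> ?N u"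
    proof (cases "\<exists>w\<in>W. w \<in> ?N u")
      case True
      then obtain w where "w \<in> W" "u \<in> ?N w" using Nsym by blast
      then show ?thesis using z[of w] that(1,4) by blast
    next
      case False
      then show ?thesis using that(1,2,3,5) Nsym by (auto simp: D_def Y_def)
    qed
    then show ?thesis
    proof cases
      case 1
      then show ?thesis
        using hv odd_at_v u odd_colors_odd_card[OF fin[of v]] by (auto simp: W_def degree_def)
    next
      case 2
      then have "?N u = insert v {z u}" using z by blast
      moreover have "odd_colors ?f {z u} \<noteq> {?f v}"
      proof -
        have "?f (z u) \<noteq> ?f v"
        proof -
          have "f (z u) \<in> F" using 2 by (auto simp: F_def)
          then show ?thesis using a fv fo[OF zD[OF 2]] by auto
        qed
        then show ?thesis using odd_colors_subset[of ?f "{z u}"] by auto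
      qed
      ultimately show ?thesis using odd_colors_insert[of "{z u}" v ?f] z[OF 2] by auto
    next
      case 3
      show ?thesis
      proof (cases "odd (degree G u)")
        case True then show ?thesis using odd_colors_odd_card[OF fin[of u]] by (simp add: degree_def)
      next
        case False
        have un: "u \<in> ?N v" "u \<notin> W" using 3 by (auto simp: Y_def)
        then have uYe: "u \<in> Ye" using False 3 Yeo by (auto simp: Yo_def)
        have nD: "x \<notin> D" if "x \<in> ?N u - {v}" for x
          using that tri[of u v x] un W by (auto simp: D_def)
        have "odd_colors ?f (?N u - {v}) = odd_colors f (?N u - {v})"
          using fo nD by (intro odd_colors_cong) auto
        moreover have "odd_colors f (?N u - {v}) \<noteq> {a}"
        proof
          assume "odd_colors f (?N u - {v}) = {a}"
          then have "a \<in> F" using uYe unfolding F_def by (force simp: image_iff)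
          then show False using a by simp
        qed
        ultimately have "odd_colors ?f (insert v (?N u - {v})) \<noteq> {}"
          using fin[of u] fv by (intro odd_colors_insert) auto
        moreover have "insert v (?N u - {v}) = ?N u" using un Nsym by blast
        ultimately show ?thesis by simp
      qed
    next
      case 4
      have wu: "w \<in> ?N u" "u \<in> ?N w" using 4 z Nsym by blast+
      have nD: "x \<notin> D" if x: "x \<in> ?N u - {w}" for x
      proof
        assume "x \<in> D"
        then consider "x = v" | "x \<in> W" by (auto simp: D_def)
        then show False
        proof cases
          case 1
          then have "u \<in> ?N v" using x Nsym by blast
          then show False using tri[of w v u] 4 W wu by blast
        next
          case 2
          then have "x = w" using sq[of x v u w] W 4 wu x z by blast
          then show False using x by simp
        qed
      qed
      have "odd_colors ?f (?N u - {w}) = odd_colors f (?N u - {w})"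
        using fo nD by (intro odd_colors_cong) auto
      moreover have "odd_colors f (?N u - {w}) \<noteq> {h w}"
        using h(2)[of w] 4 by (auto simp: Fw_def)
      ultimately have "odd_colors ?f (insert w (?N u - {w})) \<noteq> {}"
        using fin[of u] fW 4 by (intro odd_colors_insert) auto
      moreover have "insert w (?N u - {w}) = ?N u" using wu by blast
      ultimately show ?thesis by simp
    next
      case 5
      then have eq: "?N u - D = ?N u" by (auto simp: D_def)
      have "?N u \<noteq> {}" using u(2) by (auto simp: degree_def)
      then have "odd_colors f (?N u) \<noteq> {}" using oddH[of u] u(1) 5(1) eq by auto
      moreover have "odd_colors ?f (?N u) = odd_colors f (?N u)"
        using eq fo by (intro odd_colors_cong) auto
      ultimately show ?thesis by simp
    qed
  qed
  then have "odd_coloring G c ?f" using proper odd_coloring_iff[OF G(1)] by blast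
  then show ?thesis by (auto simp: odd_colorable_def)
qed

lemma sum_card_neighbors_swap:
  assumes "pair_graph G" "finite A" "finite B"
  shows "(\<Sum>v\<in>A. card (neighbors G v \<inter> B)) = (\<Sum>w\<in>B. card (neighbors G w \<inter> A))"
proof -
  have eq: "card (neighbors G v \<inter> C) = (\<Sum>w\<in>C. if (v, w) \<in> parcs G then 1 else 0)" if "finite C" for v C
    using that by (simp add: neighbors_def sum.If_cases Int_def conj_commute)
  have sym: "(w, v) \<in> parcs G \<longleftrightarrow> (v, w) \<in> parcs G" for v w using pair_graph_basic(4)[OF assms(1)] by blast
  show ?thesis unfolding eq[OF assms(2)] eq[OF assms(3)]
    by (subst sum.swap) (simp add: sym)
qed

lemma sum_degree:
  assumes "pair_graph G" shows "(\<Sum>v\<in>pverts G. degree G v) = card (parcs G)"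
proof -
  have "parcs G = (SIGMA v:pverts G. neighbors G v)"
    using pair_graph_basic(3)[OF assms] by (auto simp: neighbors_def)
  then show ?thesis
    using card_SigmaI[of "pverts G" "neighbors G"] pair_graph_basic(1)[OF assms] finite_neighbors[OF assms]
    by (simp add: degree_def)
qed

section \<open>Discharging\<close>

lemma degree_split:
  assumes "pair_graph G"
  shows "degree G v = card {y \<in> neighbors G v. degree G y \<noteq> 2 \<and> even (degree G y)} +
    card {y \<in> neighbors G v. odd (degree G y)} + card (two_neighbors G v)" (is "_ = card ?E + card ?O + _")
proof -
  have fin: "finite (neighbors G v)" by (rule finite_neighbors[OF assms])
  have "neighbors G v = (?E \<union> ?O) \<union> two_neighbors G v" by (auto simp: two_neighbors_def)
  then have "degree G v = card ((?E \<union> ?O) \<union> two_neighbors G v)" by (simp add: degree_def)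
  also have "\<dots> = card (?E \<union> ?O) + card (two_neighbors G v)"
    using fin by (intro card_Un_disjoint) (auto simp: two_neighbors_def)
  also have "card (?E \<union> ?O) = card ?E + card ?O"
    using fin by (intro card_Un_disjoint) auto
  finally show ?thesis .
qed

text \<open>No vertex is reducible in the sense of \<open>reducible_vertex\<close>: the state of a
  minimal counterexample, to be excluded by counting.\<close>

definition locally_saturated :: "'a pair_pre_digraph \<Rightarrow> nat \<Rightarrow> bool" where
  "locally_saturated G c \<longleftrightarrow> (\<forall>v\<in>pverts G.
    degree G v = 0 \<or> odd (degree G v) \<or> two_neighbors G v \<noteq> {} \<longrightarrow> c \<le> forbidden_bound G v)"

lemma two_neighbors_eq: "pair_graph G \<Longrightarrow> two_neighbors G v = neighbors G v \<inter> {w \<in> pverts G. degree G w = 2}"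
  using pair_graph_basic(3)[of G] by (auto simp: two_neighbors_def neighbors_def)

lemma sum_two_neighbors:
  assumes "pair_graph G"
  shows "(\<Sum>v\<in>pverts G. card (two_neighbors G v)) = 2 * card {w \<in> pverts G. degree G w = 2}"
proof -
  let ?T = "{w \<in> pverts G. degree G w = 2}"
  note basic = pair_graph_basic[OF assms]
  have N: "neighbors G w \<inter> pverts G = neighbors G w" for w using basic(3) by (auto simp: neighbors_def)
  have "(\<Sum>v\<in>pverts G. card (two_neighbors G v)) = (\<Sum>w\<in>?T. degree G w)"
    unfolding two_neighbors_eq[OF assms] degree_def
    using sum_card_neighbors_swap[OF assms, of "pverts G" ?T] basic(1) by (simp add: N degree_def)
  then show ?thesis by simp
qed

text \<open>Charges are multiplied by \<open>c + 2\<close>. The amount taken is chosen so that a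
  vertex of degree two ends with exactly \<open>2 + 2 (c - 2) / (c + 2) = 4 c / (c + 2)\<close>. At
  the other vertices with \<open>k > 0\<close> or odd degree, saturation limits \<open>k\<close> to
  \<open>2 d - c\<close>.\<close>

lemma sum_degree_ge6:
  assumes G: "pair_graph G" and sat: "locally_saturated G c" and c: "c \<ge> 6"
  shows "4 * c * card (pverts G) \<le> (c + 2) * card (parcs G)"
proof -
  let ?V = "pverts G" and ?T = "{w \<in> pverts G. degree G w = 2}"
  have finV: "finite ?V" using pair_graph_basic[OF G] by blast
  have pt: "4 * c + (c - 2) * card (two_neighbors G v) \<le>
      (c + 2) * degree G v + (if v \<in> ?T then 2 * (c - 2) else 0)" if v: "v \<in> ?V" for v
  proof -
    let ?d = "degree G v" and ?k = "card (two_neighbors G v)"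
    have finW: "finite (two_neighbors G v)"
      using finite_neighbors[OF G, of v] by (simp add: two_neighbors_def)
    have dk: "?k \<le> ?d" "forbidden_bound G v \<le> 2 * ?d - ?k" "?k \<le> 2 * ?d"
      using degree_split[OF G, of v] by (simp_all add: forbidden_bound_def)
    have cond: "c \<le> 2 * ?d - ?k" if "?d = 0 \<or> odd ?d \<or> ?k \<noteq> 0"
    proof -
      have "?d = 0 \<or> odd ?d \<or> two_neighbors G v \<noteq> {}" using that finW by auto
      then show ?thesis using sat v dk(2) unfolding locally_saturated_def by (meson order_trans)
    qed
    obtain e where e: "c = e + 6" using c le_Suc_ex by (metis add.commute)
    show ?thesis
    proof (cases "?d = 2")
      case True
      have "?k = 0"
      proof (rule ccontr)
        assume "?k \<noteq> 0"
        then have "c \<le> 2 * ?d - ?k" using cond by blast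
        then show False using True c by simp
      qed
      then show ?thesis using True v e by simp
    next
      case False
      show ?thesis
      proof (cases "?d = 0 \<or> odd ?d \<or> ?k \<noteq> 0")
        case True
        then have k: "c + ?k \<le> 2 * ?d" using cond dk(3) by fastforce
        have "4 * c + (c - 2) * ?k \<le> (c + 2) * ?d"
        \<comment> \<open>For \<open>d \<ge> c\<close> even \<open>d\<close> neighbours of degree
          two leave scaled charge \<open>4 d \<ge> 4 c\<close>. For smaller \<open>d\<close> the
          slack \<open>j\<close> of the saturation bound is needed.\<close>
        proof (cases "c \<le> ?d")
          case True
          have "4 * c + (c - 2) * ?k \<le> 4 * ?d + (c - 2) * ?d"
            using True mult_le_mono2[OF dk(1)] by (intro add_mono) auto
          also have "\<dots> = (c + 2) * ?d" using e by (simp add: algebra_simps)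
          finally show ?thesis .
        next
          case False
          then obtain r where r: "c = ?d + r" using le_Suc_ex nat_le_linear by blast
          obtain j where j: "2 * ?d = c + ?k + j" using k le_Suc_ex by blast
          define d k where "d = int ?d" and "k = int ?k"
          have sub: "int r = int c - d" "int e = int c - 6" "int j = 2 * d - int c - k"
            using r j e by (simp_all add: d_def k_def)
          \<comment> \<open>Both summands are nonnegative because \<open>e = c - 6\<close> and
            \<open>r = c - d\<close>. For \<open>c = 5\<close> the factor \<open>c - 6\<close> would
            be negative.\<close>
          have "(int c + 2) * d - (4 * int c + (int c - 2) * k) =
              int e * int r + (int c - 2) * int j" unfolding sub by (simp add: algebra_simps)
          moreover have "int e * int r + (int c - 2) * int j \<ge> 0" using c by simp
          ultimately have "4 * int c + (int c - 2) * k \<le> (int c + 2) * d" by linarith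
          moreover have "int (4 * c + (c - 2) * ?k) = 4 * int c + (int c - 2) * k"
            using e by (simp add: k_def)
          moreover have "int ((c + 2) * ?d) = (int c + 2) * d" by (simp add: d_def algebra_simps)
          ultimately show ?thesis by linarith
        qed
        then show ?thesis by simp
      next
        case n: False
        then have "?d \<ge> 4" using False by presburger
        then have "(c + 2) * 4 \<le> (c + 2) * ?d" by (rule mult_left_mono) simp
        then show ?thesis using n by simp
      qed
    qed
  qed
  have "(\<Sum>v\<in>?V. 4 * c + (c - 2) * card (two_neighbors G v)) \<le>
      (\<Sum>v\<in>?V. (c + 2) * degree G v + (if v \<in> ?T then 2 * (c - 2) else 0))"
    using pt by (intro sum_mono) blast
  also have "\<dots> = (c + 2) * card (parcs G) + 2 * (c - 2) * card ?T"
    unfolding sum.distrib sum_distrib_left[symmetric] sum_degree[OF G]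
    using finV by (simp add: sum.If_cases Int_def)
  finally show ?thesis
    unfolding sum.distrib sum_distrib_left[symmetric] sum_two_neighbors[OF G] by (simp add: algebra_simps)
qed

text \<open>The balance multiplied by ten, with \<open>e\<close>, \<open>p\<close>, \<open>k\<close>
  neighbours of even degree other than two, of odd degree, and of degree two: 28 is the target
  \<open>14/5\<close>, each neighbour of degree two takes \<open>2/5\<close>, each of
  \<open>s\<close> poor neighbours of degree three takes \<open>1/10\<close>, and a poor vertex
  receives two such gifts. Equality occurs for \<open>d = 3\<close>, \<open>k = 1\<close> and for
  \<open>d = 4\<close>, \<open>k = 3\<close>.\<close>

lemma charge_degree_5:
  fixes d e p k s :: nat
  assumes d: "d = e + p + k" "d \<noteq> 2" and cond: "d = 0 \<or> odd d \<or> k \<noteq> 0 \<Longrightarrow> 5 \<le> 2 * e + p + k"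
    and s: "s \<le> p" "odd d \<Longrightarrow> s = 0"
  shows "28 + 4 * k + s \<le> 10 * d + (if d = 3 \<and> k = 1 then 2 else 0)"
proof -
  consider "d = 0" | "d = 1" | "d = 3" | "d = 4" | "d = 5" | "d \<ge> 6"
    using d(2) by linarith
  then show ?thesis
  proof cases
    case 1 then show ?thesis using cond d by simp
  next
    case 2 then show ?thesis using cond d by simp
  next
    case 3
    then have "5 \<le> 2 * e + p + k" "s = 0" using cond s(2) by auto
    then show ?thesis using d 3 by simp
  next
    case 4
    show ?thesis
    proof (cases "k = 0")
      case True then show ?thesis using 4 d s(1) by simp
    next
      case False
      then have "5 \<le> 2 * e + p + k" using cond by simp
      then show ?thesis using d 4 s(1) by simp
    qed
  next
    case 5 then show ?thesis using d s(2) by simp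
  next
    case 6 then show ?thesis using d(1) s(1) by simp
  qed
qed

text \<open>For \<open>c = 5\<close> a vertex of degree three with a neighbour of degree two only has charge
  \<open>3 - 2/5\<close> left; its other two neighbours have even degree at least four and give it \<open>1/10\<close> each.\<close>

lemma sum_degree_5:
  assumes G: "pair_graph G" and sat: "locally_saturated G 5"
  shows "14 * card (pverts G) \<le> 5 * card (parcs G)"
proof -
  let ?V = "pverts G" and ?T = "{w \<in> pverts G. degree G w = 2}"
  let ?k = "\<lambda>v. card (two_neighbors G v)"
  let ?E = "\<lambda>v. card {y \<in> neighbors G v. degree G y \<noteq> 2 \<and> even (degree G y)}"
  let ?O = "\<lambda>v. card {y \<in> neighbors G v. odd (degree G y)}"
  define S where "S = {w \<in> ?V. degree G w = 3 \<and> ?k w = 1}"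
  define s where "s = (\<lambda>v. card (neighbors G v \<inter> S))"
  note basic = pair_graph_basic[OF G]
  have finV: "finite ?V" by (rule basic(1))
  have finN: "finite (neighbors G v)" for v by (rule finite_neighbors[OF G])
  have finW: "finite (two_neighbors G v)" for v
    using finN[of v] by (simp add: two_neighbors_def)
  have d: "degree G v = ?E v + ?O v + ?k v" for v by (rule degree_split[OF G])
  have cond: "5 \<le> 2 * ?E v + ?O v + ?k v" if "v \<in> ?V" "degree G v = 0 \<or> odd (degree G v) \<or> ?k v \<noteq> 0" for v
  proof -
    have "degree G v = 0 \<or> odd (degree G v) \<or> two_neighbors G v \<noteq> {}" using that finW[of v] by auto
    then show ?thesis using sat that(1) by (auto simp: locally_saturated_def forbidden_bound_def)
  qed
  have sO: "s v \<le> ?O v" for v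
    unfolding s_def S_def using finN[of v] by (intro card_mono) auto
  \<comment> \<open>Saturation at a vertex of \<open>S\<close> reads
    \<open>5 \<le> 2 e + p + 1\<close> with \<open>e + p = 2\<close>, which forces
    \<open>p = 0\<close>: it has no neighbour of odd degree.\<close>
  have s0: "s v = 0" if "v \<in> ?V" "odd (degree G v)" for v
  proof -
    have False if w: "w \<in> neighbors G v" "w \<in> S" for w
    proof -
      have "w \<in> ?V" "degree G w = 3" "?k w = 1" using w by (auto simp: S_def)
      then have "?O w = 0" using cond[of w] d[of w] by simp
      then have "{y \<in> neighbors G w. odd (degree G y)} = {}" using finN[of w] by simp
      moreover have "v \<in> neighbors G w" using w(1) basic(4) by (auto simp: neighbors_def)
      ultimately show False using \<open>odd (degree G v)\<close> by blast
    qed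
    then have "neighbors G v \<inter> S = {}" by blast
    then show ?thesis by (simp add: s_def)
  qed
  \<comment> \<open>A vertex of \<open>S\<close> is paid by its neighbours outside \<open>?T\<close>
    only. There are two of them, so the gifts paid and received both sum to
    \<open>2 * card S\<close>.\<close>
  have pt: "28 + 4 * ?k v + (if v \<in> ?V - ?T then s v else 0) \<le>
      10 * degree G v + (if v \<in> ?T then 8 else 0) + (if v \<in> S then 2 else 0)" if v: "v \<in> ?V" for v
  proof (cases "v \<in> ?T")
    case True
    then have "?k v = 0" using cond[OF v] d[of v] by fastforce
    then show ?thesis using True by simp
  next
    case False
    then have d2: "degree G v \<noteq> 2" using v by simp
    have S: "v \<in> S \<longleftrightarrow> degree G v = 3 \<and> ?k v = 1" using v by (simp add: S_def)
    have "28 + 4 * ?k v + s v \<le> 10 * degree G v + (if degree G v = 3 \<and> ?k v = 1 then 2 else 0)"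
      by (rule charge_degree_5[OF d d2 cond[OF v] sO s0[OF v]])
    then show ?thesis using False S v by simp
  qed
  have "(\<Sum>v\<in>?V. 28 + 4 * ?k v + (if v \<in> ?V - ?T then s v else 0)) \<le>
      (\<Sum>v\<in>?V. 10 * degree G v + (if v \<in> ?T then 8 else 0) + (if v \<in> S then 2 else 0))"
    using pt by (intro sum_mono) blast
  also have "\<dots> = 10 * card (parcs G) + 8 * card ?T + 2 * card S"
  proof -
    have "?V \<inter> S = S" "?V \<inter> {v. degree G v = 2} = ?T" by (auto simp: S_def)
    then show ?thesis
      unfolding sum.distrib sum_distrib_left[symmetric] sum_degree[OF G]
      using finV by (simp add: sum.If_cases)
  qed
  also have "(\<Sum>v\<in>?V. 28 + 4 * ?k v + (if v \<in> ?V - ?T then s v else 0)) =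
      28 * card ?V + 8 * card ?T + 2 * card S"
  proof -
    have "(\<Sum>v\<in>?V. if v \<in> ?V - ?T then s v else 0) = (\<Sum>v\<in>?V - ?T. s v)"
      using finV by (subst sum.inter_restrict[symmetric]) (auto intro!: sum.cong)
    also have "\<dots> = (\<Sum>w\<in>S. card (neighbors G w \<inter> (?V - ?T)))"
      unfolding s_def using finV by (intro sum_card_neighbors_swap[OF G]) (auto simp: S_def)
    also have "\<dots> = (\<Sum>w\<in>S. 2)"
    proof (rule sum.cong)
      fix w assume w: "w \<in> S"
      have "neighbors G w \<inter> (?V - ?T) = neighbors G w - two_neighbors G w"
        using basic(3) by (auto simp: two_neighbors_def neighbors_def)
      also have "card \<dots> = degree G w - ?k w"
        unfolding degree_def using finW by (intro card_Diff_subset) (auto simp: two_neighbors_def)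
      finally show "card (neighbors G w \<inter> (?V - ?T)) = 2" using w by (simp add: S_def)
    qed simp
    finally show ?thesis
      unfolding sum.distrib sum_distrib_left[symmetric] sum_two_neighbors[OF G] by simp
  qed
  finally show ?thesis by simp
qed

text \<open>Induction on the number of vertices. The predicate \<open>P\<close> collects what
  deletion preserves, so planarity enters only through \<open>sparse\<close>.\<close>

theorem odd_colorable_if_sparse:
  fixes G :: "'a pair_pre_digraph"
  assumes c: "c \<ge> 5"
    and hered: "\<And>H :: 'a pair_pre_digraph. \<And>D. P H \<Longrightarrow> P (delete_verts H D)"
    and P: "\<And>H :: 'a pair_pre_digraph. P H \<Longrightarrow> pair_graph H \<and> girth H \<ge> 5"
    and sparse: "\<And>H :: 'a pair_pre_digraph. P H \<Longrightarrow> pverts H \<noteq> {} \<Longrightarrow> \<not> locally_saturated H c"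
    and "P G"
  shows "odd_colorable G c"
  using \<open>P G\<close>
proof (induction "card (pverts G)" arbitrary: G rule: less_induct)
  case less
  have G: "pair_graph G" "girth G \<ge> 5" using P[OF less.prems] by auto
  show ?case
  proof (cases "pverts G = {}")
    case True
    then have "parcs G = {}" using pair_graph_basic(3)[OF G(1)] by auto
    then have "odd_coloring G c (\<lambda>_. 0)"
      using True by (simp add: odd_coloring_def proper_coloring_def)
    then show ?thesis by (auto simp: odd_colorable_def)
  next
    case False
    obtain v where v: "v \<in> pverts G" "degree G v = 0 \<or> odd (degree G v) \<or> two_neighbors G v \<noteq> {}"
        "\<not> c \<le> forbidden_bound G v"
      using sparse[OF less.prems False] unfolding locally_saturated_def by blast
    then have few: "forbidden_bound G v < c" by simp
    let ?H = "delete_verts G (insert v (two_neighbors G v))"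
    have "card (pverts ?H) < card (pverts G)"
      using v(1) pair_graph_basic(1)[OF G(1)] by (intro psubset_card_mono) auto
    then have "odd_colorable ?H c" using less.hyps hered[OF less.prems] by blast
    then obtain f where "odd_coloring ?H c f" by (auto simp: odd_colorable_def)
    then show ?thesis by (rule reducible_vertex[OF G c v(1,2) few])
  qed
qed

theorem corollary1p4:
  fixes G :: "'a pair_pre_digraph" and c :: nat
  assumes "c \<ge> 5"
    and "pair_graph G"
    and "planar G"
    and "girth G \<ge> enat (nat \<lceil>4 * real c / (real c - 2)\<rceil>)"
  shows "odd_colorable G c"
proof -
  define g where "g = nat \<lceil>4 * real c / (real c - 2)\<rceil>"
  have c2: "real c - 2 > 0" using assms(1) by simp
  have "4 * real c / (real c - 2) \<le> real g" unfolding g_def by linarith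
  then have "4 * real c \<le> real g * (real c - 2)" using c2 by (simp add: pos_divide_le_eq)
  then have "real_of_int (4 * int c) \<le> real_of_int (int g * (int c - 2))" by simp
  \<comment> \<open>Equivalently, \<open>2 g / (g - 2) \<le> 4 c / (c + 2)\<close>, the comparison
    of average degrees.\<close>
  then have gc: "4 * int c \<le> int g * (int c - 2)" by (simp only: of_int_le_iff)
  have "4 * real c / (real c - 2) > 4" using c2 by (simp add: pos_less_divide_eq)
  then have g5: "g \<ge> 5" unfolding g_def by linarith
  define P where "P = (\<lambda>H :: 'a pair_pre_digraph. pair_graph H \<and> planar H \<and> girth H \<ge> enat g)"
  show ?thesis
  proof (rule odd_colorable_if_sparse[of c P])
    show "P (delete_verts H D)" if "P H" for H D
      using that girth_delete_verts[of H D] pair_graph_delete_verts[of H D] planar_delete_verts[of H D]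
      unfolding P_def by (meson order_trans)
    show "pair_graph H \<and> girth H \<ge> 5" if "P H" for H
    proof -
      have "enat 5 \<le> enat g" using g5 by simp
      then show ?thesis using that unfolding P_def numeral_eq_enat by (meson order_trans)
    qed
    show "\<not> locally_saturated H c" if H: "P H" "pverts H \<noteq> {}" for H
    proof
      assume sat: "locally_saturated H c"
      have "pair_graph H" using H by (simp add: P_def)
      have bound: "(g - 2) * card (parcs H) < 2 * g * card (pverts H)"
        using H g5 unfolding P_def by (intro planar_girth_edge_bound) auto
      show False
      proof (cases "c = 5")
        case True
        \<comment> \<open>\<open>20/3\<close> rounds up to 7, and the edge bound gives average
          degree below \<open>2 * 7 / 5 = 14/5\<close>, exactly the value that
          \<open>sum_degree_5\<close> demands.\<close>
        have "g = 7" unfolding g_def True by (simp add: ceiling_eq_iff)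
        then show False using bound sum_degree_5[of H] \<open>pair_graph H\<close> sat True by simp
      next
        case False
        define n m where "n = int (card (pverts H))" and "m = int (card (parcs H))"
        have "4 * c * card (pverts H) \<le> (c + 2) * card (parcs H)"
          using sum_degree_ge6[of H c] \<open>pair_graph H\<close> sat False assms(1) by simp
        then have "int (4 * c * card (pverts H)) \<le> int ((c + 2) * card (parcs H))" by linarith
        then have low: "4 * int c * n \<le> (int c + 2) * m" by (simp add: n_def m_def algebra_simps)
        have "int ((g - 2) * card (parcs H)) < int (2 * g * card (pverts H))" using bound by linarith
        then have up: "(int g - 2) * m < 2 * int g * n"
          using g5 by (simp add: n_def m_def of_nat_diff algebra_simps)
        have "(int g - 2) * (4 * int c * n) \<le> (int g - 2) * ((int c + 2) * m)"
          using low g5 by (intro mult_left_mono) auto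
        also have "\<dots> = (int c + 2) * ((int g - 2) * m)" by (simp add: algebra_simps)
        also have "\<dots> < (int c + 2) * (2 * int g * n)"
          using up by (intro mult_strict_left_mono) auto
        finally have "2 * n * (int g * (int c - 2)) < 2 * n * (4 * int c)" by (simp add: algebra_simps)
        moreover have "2 * n * (4 * int c) \<le> 2 * n * (int g * (int c - 2))"
          using gc by (intro mult_left_mono) (auto simp: n_def)
        ultimately show False by linarith
      qed
    qed
    show "P G" using assms g_def by (simp add: P_def)
  qed (use assms in simp)
qed

end
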